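(* Let $r>0$, $\sigma^2>0$, $\Omega\in\mathbb{R}\setminus\{0\}$ and $\rho=\frac{2\sigma^2}{r}$. The Hermite-Laguerre-Ito polynomials $J_{m,n}(z,\rho)$, $z=x+\mathrm{i}y$, $m,n\ge 0$, are the eigenfunctions (up to multiplicative constants) of the 2-dimensional normal Ornstein-Uhlenbeck operator $$A = (-rx+\Omega y)\frac{\partial}{\partial x} + (-\Omega x-ry)\frac{\partial}{\partial y} +\sigma^2\Big(\frac{\partial^2}{\partial x^2}+\frac{\partial^2}{\partial y^2}\Big)$$ on $L^2_{\mathbb{C}}(\mu)$ with respect to the eigenvalues $-(m+n)r-\mathrm{i}(m-n)\Omega$. Moreover, the operator $A$ on the Hilbert space $L^2_{\mathbb{C}}(\mu)$ has a pure point spectrum.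
   Context: $\mathrm{i}=\sqrt{-1}$. The measure $\mu$ on $\mathbb{R}^2\cong\mathbb{C}$ is $\mathrm{d}\mu=\frac{r}{2\pi\sigma^2}\exp\{-\frac{r(x^2+y^2)}{2\sigma^2}\}\,\mathrm{d}x\,\mathrm{d}y=\frac{1}{\pi\rho}e^{-|z|^2/\rho}\,\mathrm{d}x\,\mathrm{d}y$; $L^2_{\mathbb{C}}(\mu)$ has inner product $\langle f,g\rangle=\int_{\mathbb{R}^2}f\bar g\,\mathrm{d}\mu$. As an operator in $L^2_{\mathbb{C}}(\mu)$, $A$ is the generator of the Ornstein-Uhlenbeck semigroup $P_t=e^{tA}$, $P_t\varphi(x)=\frac{1}{\pi\rho(1-e^{-2rt})}\int_{\mathbb{R}^2}e^{-\frac{|y|^2}{\rho(1-e^{-2rt})}}\varphi(e^{tB}x-y)\,\mathrm{d}y$ for $t>0$, with $B=\begin{bmatrix}-r&\Omega\\-\Omega&-r\end{bmatrix}$; on polynomials it acts by the displayed differential expression. Pure point spectrum means that the eigenfunctions have dense linear span. With $\frac{\partial}{\partial z}=\frac12(\frac{\partial}{\partial x}-\mathrm{i}\frac{\partial}{\partial y})$ and $\frac{\partial}{\partial\bar z}=\frac12(\frac{\partial}{\partial x}+\mathrm{i}\frac{\partial}{\partial y})$, define the complex creation operators $(\partial^*\phi)(z)=-\frac{\partial}{\partial\bar z}\phi(z)+\frac{z}{\rho}\phi(z)$ and $(\bar\partial^*\phi)(z)=-\frac{\partial}{\partial z}\phi(z)+\frac{\bar z}{\rho}\phi(z)$. The Hermite-Laguerre-Ito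 polynomials are $J_{0,0}(z,\rho)=1$, $J_{m,n}(z,\rho)=\rho^{m+n}(\partial^* )^m(\bar\partial^* )^n1$ for integers $m,n\ge0$. *)

theory Defs
  imports "HOL-Analysis.Analysis"
begin

text \<open>Elements of the Hilbert space \<open>L\<^sup>2(M; \<complex>)\<close> are represented by functions; identification
  up to null sets is made explicit where it matters.\<close>

definition L2 :: "'a measure \<Rightarrow> ('a \<Rightarrow> complex) set" where
  "L2 M = {f \<in> borel_measurable M. integrable M (\<lambda>x. (cmod (f x))\<^sup>2)}"

definition L2_inner :: "'a measure \<Rightarrow> ('a \<Rightarrow> complex) \<Rightarrow> ('a \<Rightarrow> complex) \<Rightarrow> complex" where
  "L2_inner M f g = (\<integral>x. f x * cnj (g x) \<partial>M)"

definition L2_norm :: "'a measure \<Rightarrow> ('a \<Rightarrow> complex) \<Rightarrow> real" where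
  "L2_norm M f = sqrt (Re (L2_inner M f f))"

text \<open>Unbounded operators are given by their graphs. In the generator of a semigroup \<open>P\<close>,
  membership of \<open>P t f\<close> in \<open>L\<^sup>2\<close> is required explicitly, since \<^const>\<open>L2_norm\<close> is meaningless
  (it vanishes) on functions that are not square integrable; for a semigroup on \<open>L\<^sup>2\<close> the
  requirement always holds.\<close>

definition generator ::
    "'a measure \<Rightarrow> (real \<Rightarrow> ('a \<Rightarrow> complex) \<Rightarrow> 'a \<Rightarrow> complex) \<Rightarrow> (('a \<Rightarrow> complex) \<times> ('a \<Rightarrow> complex)) set" where
  "generator M P = {(f, g). f \<in> L2 M \<and> g \<in> L2 M \<and> (\<forall>t>0. P t f \<in> L2 M) \<and>
     ((\<lambda>t. L2_norm M (\<lambda>x. (P t f x - f x) / of_real t - g x)) \<longlongrightarrow> 0) (at_right 0)}"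

definition eigenfunction ::
    "'a measure \<Rightarrow> (('a \<Rightarrow> complex) \<times> ('a \<Rightarrow> complex)) set \<Rightarrow> complex \<Rightarrow> ('a \<Rightarrow> complex) \<Rightarrow> bool" where
  "eigenfunction M A lam f \<longleftrightarrow>
     f \<in> L2 M \<and> \<not> (AE x in M. f x = 0) \<and> (f, \<lambda>x. lam * f x) \<in> A"

definition pure_point_spectrum ::
    "'a measure \<Rightarrow> (('a \<Rightarrow> complex) \<times> ('a \<Rightarrow> complex)) set \<Rightarrow> bool" where
  "pure_point_spectrum M A \<longleftrightarrow>
     (\<forall>f\<in>L2 M. \<forall>e>0. \<exists>F c. finite F \<and> (\<forall>h\<in>F. \<exists>lam. eigenfunction M A lam h) \<and>
        L2_norm M (\<lambda>x. f x - (\<Sum>h\<in>F. c h * h x)) < e)"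

text \<open>The plane is identified with \<open>\<complex>\<close> throughout, \<open>z = x + \<i>y\<close>.\<close>

definition ou_measure :: "real \<Rightarrow> real \<Rightarrow> complex measure" where
  "ou_measure r \<sigma> = density lborel (\<lambda>z. ennreal
     (r / (2 * pi * \<sigma>\<^sup>2) * exp (- (r * ((Re z)\<^sup>2 + (Im z)\<^sup>2) / (2 * \<sigma>\<^sup>2)))))"

text \<open>The linear map of the matrix \<open>B\<close> with rows \<open>(-r, \<Omega>)\<close> and \<open>(-\<Omega>, -r)\<close>, and its exponential
  \<open>e\<^bsup>tB\<^esup>\<close> as the exponential series of linear maps.\<close>

definition ou_drift :: "real \<Rightarrow> real \<Rightarrow> complex \<Rightarrow> complex" where
  "ou_drift r \<Omega> z = Complex (- r * Re z + \<Omega> * Im z) (- \<Omega> * Re z - r * Im z)"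

definition ou_flow :: "real \<Rightarrow> real \<Rightarrow> real \<Rightarrow> complex \<Rightarrow> complex" where
  "ou_flow r \<Omega> t z = (\<Sum>k. (t ^ k / fact k) *\<^sub>R (ou_drift r \<Omega> ^^ k) z)"

text \<open>Only meaningful for \<open>t > 0\<close>.\<close>

definition ou_semigroup ::
    "real \<Rightarrow> real \<Rightarrow> real \<Rightarrow> real \<Rightarrow> (complex \<Rightarrow> complex) \<Rightarrow> complex \<Rightarrow> complex" where
  "ou_semigroup r \<Omega> \<rho> t \<phi> x =
     of_real (1 / (pi * \<rho> * (1 - exp (- 2 * r * t)))) *
     (\<integral>y. of_real (exp (- ((cmod y)\<^sup>2 / (\<rho> * (1 - exp (- 2 * r * t)))))) *
          \<phi> (ou_flow r \<Omega> t x - y) \<partial>lborel)"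

definition ou_operator ::
    "real \<Rightarrow> real \<Rightarrow> real \<Rightarrow> ((complex \<Rightarrow> complex) \<times> (complex \<Rightarrow> complex)) set" where
  "ou_operator r \<sigma> \<Omega> = generator (ou_measure r \<sigma>) (ou_semigroup r \<Omega> (2 * \<sigma>\<^sup>2 / r))"

definition partial_x :: "(complex \<Rightarrow> complex) \<Rightarrow> complex \<Rightarrow> complex" where
  "partial_x \<phi> z = vector_derivative (\<lambda>x. \<phi> (Complex x (Im z))) (at (Re z))"

definition partial_y :: "(complex \<Rightarrow> complex) \<Rightarrow> complex \<Rightarrow> complex" where
  "partial_y \<phi> z = vector_derivative (\<lambda>y. \<phi> (Complex (Re z) y)) (at (Im z))"

definition ou_diff_expr :: "real \<Rightarrow> real \<Rightarrow> real \<Rightarrow> (complex \<Rightarrow> complex) \<Rightarrow> complex \<Rightarrow> complex" where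
  "ou_diff_expr r \<sigma> \<Omega> \<phi> z =
     of_real (- r * Re z + \<Omega> * Im z) * partial_x \<phi> z +
     of_real (- \<Omega> * Re z - r * Im z) * partial_y \<phi> z +
     of_real (\<sigma>\<^sup>2) * (partial_x (partial_x \<phi>) z + partial_y (partial_y \<phi>) z)"

definition wirtinger :: "(complex \<Rightarrow> complex) \<Rightarrow> complex \<Rightarrow> complex" where
  "wirtinger \<phi> z = (partial_x \<phi> z - \<i> * partial_y \<phi> z) / 2"

definition wirtinger_bar :: "(complex \<Rightarrow> complex) \<Rightarrow> complex \<Rightarrow> complex" where
  "wirtinger_bar \<phi> z = (partial_x \<phi> z + \<i> * partial_y \<phi> z) / 2"

definition creation :: "real \<Rightarrow> (complex \<Rightarrow> complex) \<Rightarrow> complex \<Rightarrow> complex" where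
  "creation \<rho> \<phi> z = - wirtinger_bar \<phi> z + z / of_real \<rho> * \<phi> z"

definition creation_bar :: "real \<Rightarrow> (complex \<Rightarrow> complex) \<Rightarrow> complex \<Rightarrow> complex" where
  "creation_bar \<rho> \<phi> z = - wirtinger \<phi> z + cnj z / of_real \<rho> * \<phi> z"

definition hermite_laguerre_ito :: "nat \<Rightarrow> nat \<Rightarrow> complex \<Rightarrow> real \<Rightarrow> complex" where
  "hermite_laguerre_ito m n z \<rho> =
     of_real (\<rho> ^ (m + n)) * (creation \<rho> ^^ m) ((creation_bar \<rho> ^^ n) (\<lambda>_. 1)) z"

definition ou_eigenvalue :: "real \<Rightarrow> real \<Rightarrow> nat \<Rightarrow> nat \<Rightarrow> complex" where
  "ou_eigenvalue r \<Omega> m n =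
     - (of_nat m + of_nat n) * of_real r - \<i> * (of_nat m - of_nat n) * of_real \<Omega>"

end

theory Submission
  imports Defs "HOL-Probability.Probability" "HOL-Real_Asymp.Real_Asymp"
begin

text \<open>
  Put \<open>a = r + \<i>\<Omega>\<close> and write \<open>z'\<close> for the conjugate of \<open>z\<close>. The flow is multiplication by \<open>e\<^bsup>-ta\<^esup>\<close>, so \<open>P\<^sub>t\<close> is
  convolution with a centred Gaussian of parameter \<open>s = \<rho>(1 - e\<^bsup>-2rt\<^esup>)\<close>, followed by composition with this
  multiplication. Let \<open>H(c) = exp(c \<partial>\<^sup>2/\<partial>z\<partial>z') z\<^sup>m z'\<^sup>n\<close>. Gaussian integration by parts shows that the
  convolution maps \<open>H(c)\<close> to \<open>H(c + s)\<close>. The Hermite-Laguerre-Ito polynomials are the case \<open>c = -\<rho>\<close>, and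
  the homogeneity of \<open>H\<close> makes them eigenfunctions of every \<open>P\<^sub>t\<close>.

  The Mehler kernel is symmetric up to \<open>\<Omega> \<mapsto> -\<Omega>\<close>, so the polynomials are also eigenfunctions of the
  adjoint of \<open>P\<^sub>t\<close>. Hence an eigenfunction of the generator with eigenvalue \<open>\<lambda>\<close> is orthogonal to every
  polynomial whose eigenvalue differs from \<open>\<lambda>\<close>. As \<open>\<Omega> \<noteq> 0\<close>, the eigenvalues are pairwise different, so
  everything follows from the density of the polynomials in \<open>L\<^sup>2(\<mu>)\<close>. Their closure contains the plane
  waves (Taylor expansion), hence the trigonometric polynomials, hence by bounded pointwise limits
  the indicators of quadrants, hence all of \<open>L\<^sup>2(\<mu>)\<close> by Dynkin's theorem.
\<close>

subsection \<open>Hermite-Laguerre-Ito polynomials\<close>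

text \<open>\<open>ito m n c\<close> is \<open>z\<^sup>m\<close> times the \<open>n\<close>-th power of the conjugate of \<open>z\<close>, evolved for time \<open>c\<close> under the
  heat flow with generator \<open>\<partial>\<^sup>2/\<partial>z\<partial>z'\<close>, a quarter of the Laplacian.\<close>

fun ito :: "nat \<Rightarrow> nat \<Rightarrow> complex \<Rightarrow> complex \<Rightarrow> complex" where
  "ito 0 n c z = cnj z ^ n"
| "ito (Suc m) n c z = z * ito m n c z + c * of_nat n * ito m (n - 1) c z"

text \<open>The definition of \<open>ito\<close> recurses on the first index only. This is its
  mirror image for the second index, which restores the symmetry between \<open>z\<close> and its
  conjugate.\<close>

lemma ito_cnj_mult:
  "ito m (Suc n) c z = cnj z * ito m n c z + c * of_nat m * ito (m - 1) n c z"
proof (induction m arbitrary: n)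
  case 0
  then show ?case by simp
next
  case (Suc m)
  let ?K = "of_nat m * of_nat n * ito (m - 1) (n - 1) c z"
  \<comment> \<open>The factor \<open>of_nat m\<close> lets the recursion be read backwards for
    every \<open>m\<close>: at \<open>m = 0\<close>, where \<open>m - 1\<close> is truncated, both
    sides vanish. The next identity does the same for \<open>n\<close>.\<close>
  have 1: "of_nat m * (z * ito (m - 1) n c z) = of_nat m * ito m n c z - c * ?K"
    by (cases m) (simp_all add: algebra_simps)
  have 2: "of_nat n * ito m n c z = of_nat n * (cnj z * ito m (n - 1) c z) + c * ?K"
    by (cases n) (simp_all add: Suc algebra_simps)
  have "ito (Suc m) (Suc n) c z = cnj z * z * ito m n c z + c * ito m n c z
      + c * (of_nat m * (z * ito (m - 1) n c z)) + c * (of_nat n * ito m n c z)"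
    by (simp add: Suc algebra_simps)
  also have "\<dots> = cnj z * ito (Suc m) n c z + c * of_nat (Suc m) * ito m n c z"
    unfolding 1 2 by (simp add: algebra_simps)
  finally show ?case by simp
qed

text \<open>Every monomial of \<open>ito m n c z\<close> is a constant times
  \<open>c^k * z^(m-k) * cnj z^(n-k)\<close>, so replacing \<open>z\<close> by \<open>p * z\<close>
  and \<open>c\<close> by \<open>p * q * c\<close>, with \<open>q\<close> the conjugate of
  \<open>p\<close>, multiplies each of them by \<open>p^m * q^n\<close>.\<close>

lemma ito_scale:
  assumes "c' = p * q * c" "cnj p = q"
  shows "ito m n c' (p * z) = p ^ m * q ^ n * ito m n c z"
proof (induction m arbitrary: n)
  case 0
  then show ?case using assms by (simp add: power_mult_distrib)
next
  case (Suc m)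
  show ?case
    by (cases n; simp add: Suc algebra_simps; simp add: assms algebra_simps)
qed

lemma ito_at_0_c [simp]: "ito m n 0 z = z ^ m * cnj z ^ n"
  by (induction m) simp_all

section \<open>Calculus with Wirtinger derivatives\<close>

text \<open>A real-linear map of the plane is \<open>p * h + q * cnj h\<close> for unique
  \<open>p\<close> and \<open>q\<close>; for the derivative of \<open>f\<close> these are its two
  Wirtinger derivatives. Total differentiability makes sum, product and chain rules available, which
  partial derivatives alone would not give.\<close>

definition has_wirtinger ::
    "(complex \<Rightarrow> complex) \<Rightarrow> (complex \<Rightarrow> complex) \<Rightarrow> (complex \<Rightarrow> complex) \<Rightarrow> bool" where
  "has_wirtinger f p q \<longleftrightarrow> (\<forall>z. (f has_derivative (\<lambda>h. p z * h + q z * cnj h)) (at z))"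

lemma has_wirtinger_partial_x:
  assumes "has_wirtinger f p q"
  shows "((\<lambda>x. f (Complex x y)) has_vector_derivative p (Complex x y) + q (Complex x y)) (at x)"
proof -
  have "((\<lambda>x. Complex x y) has_derivative (\<lambda>h. of_real h)) (at x)"
    unfolding Complex_eq by (auto intro!: derivative_eq_intros)
  from has_derivative_compose[OF this assms[unfolded has_wirtinger_def, rule_format]] show ?thesis
    by (simp add: has_vector_derivative_def scaleR_conv_of_real algebra_simps)
qed

lemma has_wirtinger_partial_y:
  assumes "has_wirtinger f p q"
  shows "((\<lambda>y. f (Complex x y)) has_vector_derivative
           \<i> * (p (Complex x y) - q (Complex x y))) (at y)"
proof -
  have "((\<lambda>y. Complex x y) has_derivative (\<lambda>h. \<i> * of_real h)) (at y)"
    unfolding Complex_eq by (auto intro!: derivative_eq_intros)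
  from has_derivative_compose[OF this assms[unfolded has_wirtinger_def, rule_format]] show ?thesis
    by (simp add: has_vector_derivative_def scaleR_conv_of_real algebra_simps)
qed

text \<open>Stated as equations between functions, so that the differential operators can be
  rewritten repeatedly, as second derivatives and powers of creation operators require.\<close>

lemma has_wirtinger_simps:
  assumes "has_wirtinger f p q"
  shows "partial_x f = (\<lambda>z. p z + q z)" "partial_y f = (\<lambda>z. \<i> * (p z - q z))"
    "wirtinger f = p" "wirtinger_bar f = q"
proof -
  show *: "partial_x f = (\<lambda>z. p z + q z)" "partial_y f = (\<lambda>z. \<i> * (p z - q z))"
    using vector_derivative_at[OF has_wirtinger_partial_x[OF assms]]
      vector_derivative_at[OF has_wirtinger_partial_y[OF assms]]
    by (auto simp: partial_x_def partial_y_def fun_eq_iff)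
  show "wirtinger f = p" "wirtinger_bar f = q"
    by (simp_all add: * wirtinger_def wirtinger_bar_def fun_eq_iff algebra_simps)
qed

lemma has_wirtinger_add:
  "has_wirtinger f p q \<Longrightarrow> has_wirtinger g p' q' \<Longrightarrow>
    has_wirtinger (\<lambda>z. f z + g z) (\<lambda>z. p z + p' z) (\<lambda>z. q z + q' z)"
  unfolding has_wirtinger_def
  by (auto intro!: derivative_eq_intros simp: algebra_simps)

lemma has_wirtinger_cmult:
  "has_wirtinger f p q \<Longrightarrow> has_wirtinger (\<lambda>z. c * f z) (\<lambda>z. c * p z) (\<lambda>z. c * q z)"
  unfolding has_wirtinger_def
  by (auto intro!: derivative_eq_intros simp: algebra_simps)

lemma has_wirtinger_mult:
  "has_wirtinger f p q \<Longrightarrow> has_wirtinger g p' q' \<Longrightarrow>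
    has_wirtinger (\<lambda>z. f z * g z) (\<lambda>z. p z * g z + f z * p' z) (\<lambda>z. q z * g z + f z * q' z)"
  unfolding has_wirtinger_def
  by (auto intro!: derivative_eq_intros simp: algebra_simps)

lemma has_wirtinger_translate:
  assumes "has_wirtinger f p q"
  shows "has_wirtinger (\<lambda>y. f (w - y)) (\<lambda>y. - p (w - y)) (\<lambda>y. - q (w - y))"
proof -
  have "((\<lambda>y. w - y) has_derivative (\<lambda>h. - h)) (at z)" for z
    by (auto intro!: derivative_eq_intros)
  from has_derivative_compose[OF this assms[unfolded has_wirtinger_def, rule_format]]
  show ?thesis by (simp add: has_wirtinger_def)
qed

text \<open>The heat flow commutes with \<open>\<partial>/\<partial>z\<close> and its conjugate, so
  each derivative lowers one index of \<open>ito\<close> exactly as it does for monomials. At index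
  0 the factor \<open>of_nat\<close> cancels the truncated predecessor.\<close>

lemma has_wirtinger_ito:
  "has_wirtinger (ito m n c) (\<lambda>z. of_nat m * ito (m - 1) n c z) (\<lambda>z. of_nat n * ito m (n - 1) c z)"
proof (induction m arbitrary: n)
  case 0
  have "((\<lambda>z. cnj z ^ n) has_derivative (\<lambda>h. of_nat n * cnj z ^ (n - 1) * cnj h)) (at z)" for z
    by (rule derivative_eq_intros bounded_linear.has_derivative[OF bounded_linear_cnj] refl)+
       (simp add: mult_ac)
  then show ?case by (simp add: has_wirtinger_def ito.simps[abs_def])
next
  case (Suc m)
  let ?D = "\<lambda>m n z h. of_nat m * ito (m - 1) n c z * h + of_nat n * ito m (n - 1) c z * cnj h"
  have IH: "(ito m k c has_derivative ?D m k z) (at z)" for k z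
    using Suc by (simp add: has_wirtinger_def)
  have "((\<lambda>z. z * ito m n c z + c * of_nat n * ito m (n - 1) c z) has_derivative
      (\<lambda>h. (z * ?D m n z h + h * ito m n c z) + c * of_nat n * ?D m (n - 1) z h)) (at z)" for z
    by (intro has_derivative_add has_derivative_mult has_derivative_ident IH has_derivative_mult_right)
  moreover have "(z * ?D m n z h + h * ito m n c z) + c * of_nat n * ?D m (n - 1) z h
      = ?D (Suc m) n z h" for z h
  proof -
    have 1: "of_nat m * (z * ito (m - 1) n c z + c * of_nat n * ito (m - 1) (n - 1) c z)
        = of_nat m * ito m n c z"
      by (cases m) simp_all
    have "of_nat m * (h * (z * ito (m - 1) n c z + c * of_nat n * ito (m - 1) (n - 1) c z))
        = h * (of_nat m * (z * ito (m - 1) n c z + c * of_nat n * ito (m - 1) (n - 1) c z))"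
      by (simp add: mult_ac)
    also have "\<dots> = h * (of_nat m * ito m n c z)" unfolding 1 ..
    finally show ?thesis
      by (simp add: algebra_simps)
  qed
  ultimately show ?case
    by (simp add: has_wirtinger_def ito.simps[abs_def])
qed

text \<open>At \<open>c = -\<rho>\<close> the recursion of \<open>ito\<close> says that a creation
  operator raises an index and divides by \<open>\<rho>\<close>. The conjugate operators act first,
  while the other index is still 0, so they only multiply by \<open>cnj z / \<rho>\<close>. The
  prefactor \<open>\<rho> ^ (m + n)\<close> undoes the divisions.\<close>

lemma hermite_laguerre_ito_eq:
  assumes "\<rho> \<noteq> 0"
  shows "hermite_laguerre_ito m n z \<rho> = ito m n (of_real (- \<rho>)) z"
proof -
  let ?c = "of_real (- \<rho>) :: complex"
  have bar: "(creation_bar \<rho> ^^ n) (\<lambda>_. 1) = (\<lambda>z. of_real ((1/\<rho>)^n) * ito 0 n ?c z)" for n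
  proof (induction n)
    case (Suc n)
    have "creation_bar \<rho> (\<lambda>z. of_real ((1/\<rho>)^n) * ito 0 n ?c z) z =
        of_real ((1/\<rho>)^n) * (ito 0 (Suc n) ?c z / of_real \<rho>)" for z
      using assms
      unfolding creation_bar_def has_wirtinger_simps[OF has_wirtinger_cmult[OF has_wirtinger_ito]]
      by (simp add: field_simps)
    then show ?case
      unfolding funpow.simps o_apply Suc by (simp add: fun_eq_iff power_divide)
  qed simp
  have "(creation \<rho> ^^ m) (\<lambda>z. of_real ((1/\<rho>)^n) * ito 0 n ?c z)
      = (\<lambda>z. of_real ((1/\<rho>)^(m + n)) * ito m n ?c z)" for m
  proof (induction m)
    case (Suc m)
    have "creation \<rho> (\<lambda>z. of_real ((1/\<rho>)^(m + n)) * ito m n ?c z) z =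
        of_real ((1/\<rho>)^(m + n)) * (ito (Suc m) n ?c z / of_real \<rho>)" for z
      using assms
      unfolding creation_def has_wirtinger_simps[OF has_wirtinger_cmult[OF has_wirtinger_ito]]
      by (simp add: field_simps)
    then show ?case
      unfolding funpow.simps o_apply Suc by (simp add: fun_eq_iff power_divide)
  qed simp
  then show ?thesis
    using assms by (simp add: hermite_laguerre_ito_def bar power_divide)
qed

text \<open>In Wirtinger coordinates the drift is \<open>- a z \<partial>/\<partial>z\<close> minus
  its conjugate analogue, with \<open>a = r + \<i>\<Omega>\<close>, and the Laplacian is four times
  the mixed derivative. The drift terms produce the eigenvalue and a multiple of \<open>?K\<close>,
  which the Laplacian cancels.\<close>

lemma ou_diff_expr_ito:
  assumes "r > 0" "\<rho> = 2 * \<sigma>\<^sup>2 / r"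
  shows "ou_diff_expr r \<sigma> \<Omega> (ito m n (of_real (- \<rho>))) z
    = ou_eigenvalue r \<Omega> m n * ito m n (of_real (- \<rho>)) z"
proof -
  let ?c = "of_real (- \<rho>) :: complex"
  let ?J = "\<lambda>m n. ito m n ?c z"
  let ?K = "of_nat m * of_nat n * ?J (m - 1) (n - 1)"
  note W = has_wirtinger_simps
  have w1: "has_wirtinger (\<lambda>z. of_nat m * ito (m - 1) n ?c z)
      (\<lambda>z. of_nat m * (of_nat (m - 1) * ito (m - 1 - 1) n ?c z))
      (\<lambda>z. of_nat m * (of_nat n * ito (m - 1) (n - 1) ?c z))"
    by (intro has_wirtinger_cmult has_wirtinger_ito)
  have w2: "has_wirtinger (\<lambda>z. of_nat n * ito m (n - 1) ?c z)
      (\<lambda>z. of_nat n * (of_nat m * ito (m - 1) (n - 1) ?c z))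
      (\<lambda>z. of_nat n * (of_nat (n - 1) * ito m (n - 1 - 1) ?c z))"
    by (intro has_wirtinger_cmult has_wirtinger_ito)
  have w3: "has_wirtinger (\<lambda>z. \<i> * (of_nat m * ito (m - 1) n ?c z - of_nat n * ito m (n - 1) ?c z))
     (\<lambda>z. \<i> * (of_nat m * (of_nat (m - 1) * ito (m - 1 - 1) n ?c z)
          + (- 1) * (of_nat n * (of_nat m * ito (m - 1) (n - 1) ?c z))))
     (\<lambda>z. \<i> * (of_nat m * (of_nat n * ito (m - 1) (n - 1) ?c z)
          + (- 1) * (of_nat n * (of_nat (n - 1) * ito m (n - 1 - 1) ?c z))))"
    using has_wirtinger_cmult[OF has_wirtinger_add[OF w1 has_wirtinger_cmult[OF w2, of "-1"]], of \<i>]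
    by simp
  have lap: "partial_x (partial_x (ito m n ?c)) z + partial_y (partial_y (ito m n ?c)) z = 4 * ?K"
    unfolding W(1,2)[OF has_wirtinger_ito]
    unfolding W(1)[OF has_wirtinger_add[OF w1 w2]] W(2)[OF w3]
    by (simp add: algebra_simps)
  have z: "of_nat m * (z * ?J (m - 1) n) = of_nat m * ?J m n - ?c * ?K"
    by (cases m) (simp_all add: algebra_simps)
  have cz: "of_nat n * (cnj z * ?J m (n - 1)) = of_nat n * ?J m n - ?c * ?K"
    by (cases n) (simp_all add: ito_cnj_mult algebra_simps)
  define a where "a = of_real r + \<i> * of_real \<Omega>"
  have zz: "of_real (- r * Re z + \<Omega> * Im z) = - (a * z + cnj a * cnj z) / 2"
     "of_real (- \<Omega> * Re z - r * Im z) * \<i> = - (a * z - cnj a * cnj z) / 2"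
    by (simp_all add: a_def complex_eq_iff algebra_simps)
  have "ou_diff_expr r \<sigma> \<Omega> (ito m n ?c) z =
     of_real (- r * Re z + \<Omega> * Im z) * (of_nat m * ?J (m - 1) n + of_nat n * ?J m (n - 1)) +
     (of_real (- \<Omega> * Re z - r * Im z) * \<i>) * (of_nat m * ?J (m - 1) n - of_nat n * ?J m (n - 1)) +
     of_real (\<sigma>\<^sup>2) * (4 * ?K)"
    unfolding ou_diff_expr_def lap by (simp add: W(1,2)[OF has_wirtinger_ito] mult.assoc)
  also have "\<dots> = - a * (of_nat m * (z * ?J (m - 1) n)) - cnj a * (of_nat n * (cnj z * ?J m (n - 1)))
      + 4 * of_real (\<sigma>\<^sup>2) * ?K"
    unfolding zz by (simp add: field_simps)
  also have "\<dots> = - (a * of_nat m + cnj a * of_nat n) * ?J m n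
      + ((a + cnj a) * ?c + 4 * of_real (\<sigma>\<^sup>2)) * ?K"
    unfolding z cz by (simp add: algebra_simps)
  \<comment> \<open>This is where the value of \<open>\<rho>\<close> matters:
    \<open>a + cnj a = 2 * r\<close>, so the first term is \<open>-2 * r * \<rho>\<close>, that is,
    minus the second.\<close>
  also have "(a + cnj a) * ?c + 4 * of_real (\<sigma>\<^sup>2) = 0"
    using assms by (simp add: a_def complex_eq_iff)
  also have "- (a * of_nat m + cnj a * of_nat n) = ou_eigenvalue r \<Omega> m n"
    by (simp add: a_def ou_eigenvalue_def algebra_simps)
  finally show ?thesis by simp
qed

subsection \<open>Gaussian integrals on the plane\<close>

lemma measurable_Complex [measurable]:
  "f \<in> borel_measurable M \<Longrightarrow> g \<in> borel_measurable M \<Longrightarrow>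
    (\<lambda>x. Complex (f x) (g x)) \<in> borel_measurable M"
  unfolding Complex_eq
  by (intro borel_measurable_add borel_measurable_times borel_measurable_const
      measurable_compose[OF _ borel_measurable_continuous_onI[of of_real]] continuous_intros)

text \<open>Both measures give an open box the product of its side lengths, which characterises
  Lebesgue measure. This makes Fubini available on the complex plane.\<close>

lemma lborel_complex:
  "(lborel :: complex measure) = distr (lborel \<Otimes>\<^sub>M lborel) borel (\<lambda>p. Complex (fst p) (snd p))"
proof (rule lborel_eqI)
  fix l u :: complex
  assume "\<And>b. b \<in> Basis \<Longrightarrow> l \<bullet> b \<le> u \<bullet> b"
  from this[of 1] this[of \<i>] have le: "Re l \<le> Re u" "Im l \<le> Im u"
    by (auto simp: Basis_complex_def)
  have "(\<lambda>p. Complex (fst p) (snd p)) -` box l u \<inter> space (lborel \<Otimes>\<^sub>M lborel)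
      = {Re l<..<Re u} \<times> {Im l<..<Im u}"
    by (auto simp: box_def Basis_complex_def space_pair_measure)
  then have "emeasure (distr (lborel \<Otimes>\<^sub>M lborel) borel (\<lambda>p. Complex (fst p) (snd p))) (box l u)
      = ennreal (Re u - Re l) * ennreal (Im u - Im l)"
    using le by (simp add: emeasure_distr lborel.emeasure_pair_measure_Times)
  also have "\<dots> = (\<Prod>b\<in>Basis. (u - l) \<bullet> b)"
    using le by (simp add: Basis_complex_def ennreal_mult)
  finally show "emeasure (distr (lborel \<Otimes>\<^sub>M lborel) borel (\<lambda>p. Complex (fst p) (snd p))) (box l u)
      = (\<Prod>b\<in>Basis. (u - l) \<bullet> b)" .
qed simp

lemma integrable_lborel_complex_iff:
  fixes f :: "complex \<Rightarrow> 'b::{banach, second_countable_topology}"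
  assumes [measurable]: "f \<in> borel_measurable borel"
  shows "integrable lborel f \<longleftrightarrow>
    integrable (lborel \<Otimes>\<^sub>M lborel) (\<lambda>p. f (Complex (fst p) (snd p)))"
  by (subst lborel_complex, subst integrable_distr_eq) auto

lemma integral_lborel_complex:
  fixes f :: "complex \<Rightarrow> 'b::{banach, second_countable_topology}"
  assumes [measurable]: "f \<in> borel_measurable borel"
  shows "integral\<^sup>L lborel f = (\<integral>p. f (Complex (fst p) (snd p)) \<partial>(lborel \<Otimes>\<^sub>M lborel))"
  by (subst lborel_complex, subst integral_distr) auto

lemma has_bochner_integral_gauss_real:
  assumes "0 < s"
  shows "has_bochner_integral lborel (\<lambda>x. exp (- (x\<^sup>2 / s))) (sqrt (pi * s))"
proof -
  have "has_bochner_integral lborel (\<lambda>x. sqrt (pi * s) * normal_density 0 (sqrt (s / 2)) x) (sqrt (pi * s) * 1)"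
    using assms by (intro has_bochner_integral_mult_right) (simp add: has_bochner_integral_iff)
  then show ?thesis
    using assms by (simp add: normal_density_def power_divide)
qed

lemma has_bochner_integral_gauss_complex:
  assumes "0 < s"
  shows "has_bochner_integral lborel (\<lambda>z. exp (- ((cmod z)\<^sup>2 / s))) (pi * s)"
proof -
  note g = has_bochner_integral_gauss_real[OF assms]
  let ?f = "\<lambda>p. exp (- ((fst p)\<^sup>2 / s)) * exp (- ((snd p)\<^sup>2 / s)) :: real"
  have eq: "exp (- ((cmod (Complex (fst p) (snd p)))\<^sup>2 / s)) = ?f p" for p
    by (simp add: cmod_power2 exp_add[symmetric] add_divide_distrib)
  have i: "integrable (lborel \<Otimes>\<^sub>M lborel) ?f"
    using g by (intro lborel_pair.Fubini_integrable) (auto simp: has_bochner_integral_iff)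
  have "(\<integral>x. (\<integral>y. ?f (x, y) \<partial>lborel) \<partial>lborel) = integral\<^sup>L (lborel \<Otimes>\<^sub>M lborel) ?f"
    by (rule lborel_pair.integral_fst'[OF i])
  moreover have "(\<integral>x. (\<integral>y. ?f (x, y) \<partial>lborel) \<partial>lborel) = pi * s"
    using g assms by (simp add: has_bochner_integral_iff)
  ultimately show ?thesis
    using i by (simp add: has_bochner_integral_iff integrable_lborel_complex_iff
        integral_lborel_complex eq)
qed

text \<open>The fundamental theorem of calculus on the whole line: both boundary values are
  0.\<close>

lemma integral_vector_derivative_eq_0:
  fixes F F' :: "real \<Rightarrow> complex"
  assumes "\<And>x. (F has_vector_derivative F' x) (at x)" "continuous_on UNIV F'"
    and "integrable lborel F'" "(F \<longlongrightarrow> 0) at_top" "(F \<longlongrightarrow> 0) at_bot"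
  shows "(\<integral>x. F' x \<partial>lborel) = 0"
proof -
  have "(LBINT x=-\<infinity>..\<infinity>. F' x) = 0 - 0"
  proof (rule interval_integral_FTC_integrable)
    show "((F \<circ> real_of_ereal) \<longlongrightarrow> 0) (at_right (- \<infinity>))" "((F \<circ> real_of_ereal) \<longlongrightarrow> 0) (at_left \<infinity>)"
      using assms(4,5) by (simp_all add: at_right_MInf at_left_PInf filterlim_filtermap o_def)
  qed (use assms in \<open>auto simp: set_integrable_def continuous_on_eq_continuous_at\<close>)
  then show ?thesis
    by (simp add: interval_lebesgue_integral_def set_lebesgue_integral_def)
qed

section \<open>Functions of subgaussian growth\<close>

text \<open>The bound is required for every variance \<open>s\<close>, so that these functions form an algebra.\<close>

definition subgaussian :: "(complex \<Rightarrow> complex) \<Rightarrow> bool" where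
  "subgaussian f \<longleftrightarrow> continuous_on UNIV f \<and>
     (\<forall>s>0. \<exists>C. \<forall>z. cmod (f z) \<le> C * exp ((cmod z)\<^sup>2 / s))"

lemma subgaussianE:
  assumes "subgaussian f" "0 < s"
  obtains C where "C \<ge> 0" "\<And>z. cmod (f z) \<le> C * exp ((cmod z)\<^sup>2 / s)"
proof -
  obtain C where C: "\<And>z. cmod (f z) \<le> C * exp ((cmod z)\<^sup>2 / s)"
    using assms by (auto simp: subgaussian_def)
  from C[of 0] have "C \<ge> 0" by (simp add: order_trans[OF norm_ge_zero])
  with C show ?thesis by (rule that[rotated])
qed

lemma subgaussian_continuous_on: "subgaussian f \<Longrightarrow> continuous_on S f"
  by (auto simp: subgaussian_def intro: continuous_on_subset)

lemma subgaussian_measurable: "subgaussian f \<Longrightarrow> f \<in> borel_measurable borel"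
  by (auto simp: subgaussian_def intro: borel_measurable_continuous_onI)

lemma subgaussian_const: "subgaussian (\<lambda>_. c)"
proof -
  have "cmod c \<le> cmod c * exp ((cmod z)\<^sup>2 / s)" if "0 < s" for s z
    using that by (intro mult_left_le[of "1::real", simplified] mult_le_cancel_left1[THEN iffD2]) auto
  then show ?thesis unfolding subgaussian_def by auto
qed

lemma subgaussian_ident: "subgaussian (\<lambda>z. z)"
  unfolding subgaussian_def
proof (intro conjI allI impI exI)
  fix s :: real and z :: complex
  assume s: "0 < s"
  have "2 * cmod z \<le> 1 + (cmod z)\<^sup>2"
    using zero_le_power2[of "cmod z - 1"] by (simp add: power2_eq_square algebra_simps)
  also have "(cmod z)\<^sup>2 = s * ((cmod z)\<^sup>2 / s)" using s by simp
  also have "(cmod z)\<^sup>2 / s \<le> exp ((cmod z)\<^sup>2 / s)"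
    using exp_ge_add_one_self[of "(cmod z)\<^sup>2 / s"] by linarith
  also have "1 \<le> exp ((cmod z)\<^sup>2 / s)" using s by simp
  finally have "2 * cmod z \<le> (1 + s) * exp ((cmod z)\<^sup>2 / s)"
    using s by (simp add: algebra_simps)
  then show "cmod z \<le> (1 + s) * exp ((cmod z)\<^sup>2 / s)"
    using norm_ge_zero[of z] by linarith
qed (auto intro: continuous_intros)

lemma subgaussian_cnj:
  assumes "subgaussian f" shows "subgaussian (\<lambda>z. cnj (f z))"
  using assms by (auto simp: subgaussian_def intro!: continuous_intros)

lemma subgaussian_add:
  assumes f: "subgaussian f" and g: "subgaussian g"
  shows "subgaussian (\<lambda>z. f z + g z)"
  unfolding subgaussian_def
proof (intro conjI allI impI)
  show "continuous_on UNIV (\<lambda>z. f z + g z)"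
    using f g by (intro continuous_intros subgaussian_continuous_on)
  fix s :: real assume s: "0 < s"
  obtain C D where "\<And>z. cmod (f z) \<le> C * exp ((cmod z)\<^sup>2 / s)" "\<And>z. cmod (g z) \<le> D * exp ((cmod z)\<^sup>2 / s)"
    using subgaussianE[OF f s] subgaussianE[OF g s] by metis
  then have "cmod (f z + g z) \<le> (C + D) * exp ((cmod z)\<^sup>2 / s)" for z
    by (metis add_mono norm_triangle_le ring_class.ring_distribs(2))
  then show "\<exists>C. \<forall>z. cmod (f z + g z) \<le> C * exp ((cmod z)\<^sup>2 / s)" by blast
qed

text \<open>Using the bound of each factor for the variance \<open>2 * s\<close> gives the bound of
  the product for \<open>s\<close>.\<close>

lemma subgaussian_mult:
  assumes f: "subgaussian f" and g: "subgaussian g"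
  shows "subgaussian (\<lambda>z. f z * g z)"
  unfolding subgaussian_def
proof (intro conjI allI impI)
  show "continuous_on UNIV (\<lambda>z. f z * g z)"
    using f g by (intro continuous_intros subgaussian_continuous_on)
  fix s :: real assume s: "0 < s"
  then have s2: "0 < 2 * s" by simp
  obtain C where C: "C \<ge> 0" "\<And>z. cmod (f z) \<le> C * exp ((cmod z)\<^sup>2 / (2 * s))"
    using subgaussianE[OF f s2] by metis
  obtain D where D: "D \<ge> 0" "\<And>z. cmod (g z) \<le> D * exp ((cmod z)\<^sup>2 / (2 * s))"
    using subgaussianE[OF g s2] by metis
  have "cmod (f z * g z) \<le> (C * exp ((cmod z)\<^sup>2 / (2 * s))) * (D * exp ((cmod z)\<^sup>2 / (2 * s)))" for z
    unfolding norm_mult using C D by (intro mult_mono) auto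
  also have "(C * exp ((cmod z)\<^sup>2 / (2 * s))) * (D * exp ((cmod z)\<^sup>2 / (2 * s)))
      = (C * D) * exp ((cmod z)\<^sup>2 / s)" for z
    by (simp add: exp_add[symmetric])
  finally show "\<exists>C. \<forall>z. cmod (f z * g z) \<le> C * exp ((cmod z)\<^sup>2 / s)" by blast
qed

text \<open>Since \<open>|w - y|^2\<close> is at most \<open>2|w|^2 + 2|y|^2\<close>, the bound for
  \<open>2 * s\<close> becomes one for \<open>s\<close>, the part depending on \<open>w\<close>
  going into the constant.\<close>

lemma subgaussian_translate:
  assumes f: "subgaussian f"
  shows "subgaussian (\<lambda>y. f (w - y))"
  unfolding subgaussian_def
proof (intro conjI allI impI)
  show "continuous_on UNIV (\<lambda>y. f (w - y))"
    by (intro continuous_on_compose2[OF subgaussian_continuous_on[OF f, of UNIV]] continuous_intros) auto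
  fix s :: real assume s: "0 < s"
  then have s2: "0 < 2 * s" by simp
  obtain C where C: "C \<ge> 0" "\<And>z. cmod (f z) \<le> C * exp ((cmod z)\<^sup>2 / (2 * s))"
    using subgaussianE[OF f s2] by metis
  have "cmod (f (w - y)) \<le> (C * exp ((cmod w)\<^sup>2 / s)) * exp ((cmod y)\<^sup>2 / s)" for y
  proof -
    have "(cmod (w - y))\<^sup>2 \<le> (cmod w + cmod y)\<^sup>2"
      by (intro power_mono norm_triangle_ineq4) auto
    also have "\<dots> \<le> 2 * (cmod w)\<^sup>2 + 2 * (cmod y)\<^sup>2"
      using zero_le_power2[of "cmod w - cmod y"] by (simp add: power2_eq_square algebra_simps)
    finally have "(cmod (w - y))\<^sup>2 / (2 * s) \<le> (cmod w)\<^sup>2 / s + (cmod y)\<^sup>2 / s"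
      using s by (simp add: field_simps)
    then have "C * exp ((cmod (w - y))\<^sup>2 / (2 * s)) \<le> C * exp ((cmod w)\<^sup>2 / s + (cmod y)\<^sup>2 / s)"
      using C(1) by (intro mult_left_mono) auto
    with C(2)[of "w - y"] show ?thesis by (simp add: exp_add)
  qed
  then show "\<exists>C. \<forall>y. cmod (f (w - y)) \<le> C * exp ((cmod y)\<^sup>2 / s)" by blast
qed

lemma subgaussian_ito: "subgaussian (ito m n c)"
proof (induction m arbitrary: n)
  case 0
  show ?case
    unfolding ito.simps[abs_def]
    by (induction n)
       (auto intro: subgaussian_const subgaussian_mult subgaussian_cnj[OF subgaussian_ident])
next
  case (Suc m)
  then show ?case
    unfolding ito.simps[abs_def]
    by (intro subgaussian_add subgaussian_mult subgaussian_const subgaussian_ident)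
qed

text \<open>Complex valued, so that the product rule of \<open>has_wirtinger\<close> applies to it.
  The normalising constant is kept apart because it plays no part in differentiation.\<close>

definition gauss_fun :: "real \<Rightarrow> complex \<Rightarrow> complex" where
  "gauss_fun s z = of_real (exp (- ((cmod z)\<^sup>2 / s)))"

lemma continuous_gauss_fun [continuous_intros]: "s > 0 \<Longrightarrow> continuous_on S (gauss_fun s)"
  unfolding gauss_fun_def[abs_def] by (intro continuous_intros) auto

lemma gauss_fun_measurable [measurable]: "gauss_fun s \<in> borel_measurable borel"
  unfolding gauss_fun_def[abs_def] by measurable

text \<open>Half of the Gaussian decay pays for the growth of \<open>f\<close>. The other half
  serves both for integrability and for vanishing at infinity.\<close>

lemma subgaussian_gauss_bound:
  assumes f: "subgaussian f" and s: "0 < s"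
  obtains C where "C \<ge> 0" "\<And>y. cmod (gauss_fun s y * f y) \<le> C * exp (- ((cmod y)\<^sup>2 / (2 * s)))"
proof -
  obtain C where C: "C \<ge> 0" "\<And>z. cmod (f z) \<le> C * exp ((cmod z)\<^sup>2 / (2 * s))"
    using subgaussianE[OF f, of "2 * s"] s by auto
  have "cmod (gauss_fun s y * f y) \<le> C * exp (- ((cmod y)\<^sup>2 / (2 * s)))" for y
  proof -
    have "cmod (gauss_fun s y * f y) \<le> exp (- ((cmod y)\<^sup>2 / s)) * (C * exp ((cmod y)\<^sup>2 / (2 * s)))"
      unfolding norm_mult gauss_fun_def using C by (intro mult_mono) auto
    also have "\<dots> = C * (exp (- ((cmod y)\<^sup>2 / s)) * exp ((cmod y)\<^sup>2 / (2 * s)))" by simp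
    also have "\<dots> = C * exp (- ((cmod y)\<^sup>2 / (2 * s)))"
      unfolding exp_add[symmetric] by (simp add: field_simps)
    finally show ?thesis .
  qed
  with C(1) show ?thesis by (rule that)
qed

lemma integrable_gauss_subgaussian:
  assumes f: "subgaussian f" and s: "0 < s"
  shows "integrable lborel (\<lambda>y. gauss_fun s y * f y)"
proof -
  obtain C where C: "\<And>y. cmod (gauss_fun s y * f y) \<le> C * exp (- ((cmod y)\<^sup>2 / (2 * s)))"
    using subgaussian_gauss_bound[OF f s] by metis
  have "integrable lborel (\<lambda>y. C * exp (- ((cmod y)\<^sup>2 / (2 * s))))"
    using has_bochner_integral_gauss_complex[of "2 * s"] s
    by (intro integrable_mult_right) (auto simp: has_bochner_integral_iff)
  then show ?thesis
    by (rule Bochner_Integration.integrable_bound)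
       (use C order_trans[OF C abs_ge_self] subgaussian_measurable[OF f] in \<open>auto\<close>)
qed

section \<open>Integration by parts against the Gaussian weight\<close>

lemma tendsto_gauss_line:
  assumes s: "0 < s" and F: "\<And>x. cmod (F x) \<le> C * exp (- (x\<^sup>2 / s))"
  shows "(F \<longlongrightarrow> 0) at_top" "(F \<longlongrightarrow> 0) at_bot"
proof -
  have "((\<lambda>x. C * exp (- (x\<^sup>2 / s))) \<longlongrightarrow> 0) at_top" "((\<lambda>x. C * exp (- (x\<^sup>2 / s))) \<longlongrightarrow> 0) at_bot"
    using s by real_asymp+
  then show "(F \<longlongrightarrow> 0) at_top" "(F \<longlongrightarrow> 0) at_bot"
    using F by (auto intro: Lim_null_comparison[rotated])
qed

text \<open>\<open>P + Q\<close> and \<open>\<i> (P - Q)\<close> are the partial derivatives of \<open>F\<close>, so each integrates to 0 over the lines in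
  its direction.\<close>

lemma integral_wirtinger_bar_eq_0:
  assumes F: "has_wirtinger F P Q" and s: "0 < s"
    and bnd: "\<And>z. cmod (F z) \<le> C * exp (- ((cmod z)\<^sup>2 / s))" "C \<ge> 0"
    and cont: "continuous_on UNIV P" "continuous_on UNIV Q"
    and int: "integrable lborel P" "integrable lborel Q"
  shows "integral\<^sup>L lborel Q = 0"
proof -
  have b: "exp (- ((cmod (Complex x y))\<^sup>2 / s)) \<le> exp (- (x\<^sup>2 / s))"
    "exp (- ((cmod (Complex x y))\<^sup>2 / s)) \<le> exp (- (y\<^sup>2 / s))" for x y
    using s by (simp_all add: cmod_power2 divide_right_mono)
  have bx: "cmod (F (Complex x y)) \<le> C * exp (- (x\<^sup>2 / s))"
    and by': "cmod (F (Complex x y)) \<le> C * exp (- (y\<^sup>2 / s))" for x y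
    by (meson bnd b order_trans mult_left_mono)+
  have [measurable]: "P \<in> borel_measurable borel" "Q \<in> borel_measurable borel"
    using cont by (auto intro: borel_measurable_continuous_onI)
  let ?X = "\<lambda>z. P z + Q z" and ?Y = "\<lambda>z. \<i> * (P z - Q z)"
  have cc: "continuous_on UNIV (\<lambda>x. f (Complex x y))" "continuous_on UNIV (\<lambda>x. f (Complex y x))"
    if "continuous_on UNIV f" for f :: "complex \<Rightarrow> complex" and y
    unfolding Complex_eq by (intro continuous_on_compose2[OF that] continuous_intros; simp)+
  have cX: "continuous_on UNIV ?X" and cY: "continuous_on UNIV ?Y"
    using cont by (auto intro: continuous_intros)
  have iX: "integrable lborel ?X" and iY: "integrable lborel ?Y"
    using int by auto
  have iX': "integrable (lborel \<Otimes>\<^sub>M lborel) (\<lambda>(x, y). ?X (Complex x y))"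
    using iX by (subst (asm) integrable_lborel_complex_iff) (auto simp: case_prod_unfold)
  have iY': "integrable (lborel \<Otimes>\<^sub>M lborel) (\<lambda>(x, y). ?Y (Complex x y))"
    using iY by (subst (asm) integrable_lborel_complex_iff) (auto simp: case_prod_unfold)
  \<comment> \<open>Fubini gives integrability on almost every horizontal line only, hence the
    exceptional null set. It is harmless for the outer integral.\<close>
  have X0: "AE y in lborel. (\<integral>x. ?X (Complex x y) \<partial>lborel) = 0"
    using lborel_pair.AE_integrable_snd[OF iX']
  proof eventually_elim
    case (elim y)
    show ?case
      by (rule integral_vector_derivative_eq_0[OF has_wirtinger_partial_x[OF F] cc(1)[OF cX] elim])
         (rule tendsto_gauss_line[OF s bx])+
  qed
  have Y0: "AE x in lborel. (\<integral>y. ?Y (Complex x y) \<partial>lborel) = 0"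
    using lborel_pair.AE_integrable_fst[OF iY']
  proof eventually_elim
    case (elim x)
    show ?case
      by (rule integral_vector_derivative_eq_0[OF has_wirtinger_partial_y[OF F] cc(2)[OF cY] elim])
         (rule tendsto_gauss_line[OF s by'])+
  qed
  have "integral\<^sup>L lborel ?X = (\<integral>(x, y). ?X (Complex x y) \<partial>(lborel \<Otimes>\<^sub>M lborel))"
    by (subst integral_lborel_complex) (auto simp: case_prod_unfold)
  also have "\<dots> = (\<integral>y. (\<integral>x. ?X (Complex x y) \<partial>lborel) \<partial>lborel)"
    by (rule lborel_pair.integral_snd[OF iX', symmetric])
  also have "\<dots> = 0"
    using X0 by (rule integral_eq_zero_AE)
  finally have X: "integral\<^sup>L lborel P + integral\<^sup>L lborel Q = 0"
    using int by simp
  have "integral\<^sup>L lborel ?Y = (\<integral>(x, y). ?Y (Complex x y) \<partial>(lborel \<Otimes>\<^sub>M lborel))"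
    by (subst integral_lborel_complex) (auto simp: case_prod_unfold)
  also have "\<dots> = (\<integral>x. (\<integral>y. ?Y (Complex x y) \<partial>lborel) \<partial>lborel)"
    by (rule lborel_pair.integral_fst[OF iY', symmetric])
  also have "\<dots> = 0"
    using Y0 by (rule integral_eq_zero_AE)
  finally have "integral\<^sup>L lborel P - integral\<^sup>L lborel Q = 0"
    using int by simp
  with X show ?thesis by simp
qed

lemma has_wirtinger_gauss_fun:
  assumes "s > 0"
  shows "has_wirtinger (gauss_fun s)
    (\<lambda>z. gauss_fun s z * (- cnj z / of_real s)) (\<lambda>z. gauss_fun s z * (- z / of_real s))"
proof -
  have eq: "gauss_fun s = (\<lambda>z. exp (- (z * cnj z / of_real s)))"
    by (simp add: fun_eq_iff gauss_fun_def exp_of_real[symmetric] complex_norm_square[symmetric])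
  have "((\<lambda>z. exp (- (z * cnj z / of_real s))) has_derivative
      (\<lambda>h. exp (- (z * cnj z / of_real s)) * (- ((z * cnj h + h * cnj z) / of_real s)))) (at z)" for z
  proof -
    have "((\<lambda>z. - (z * cnj z / of_real s)) has_derivative
        (\<lambda>h. - ((z * cnj h + h * cnj z) / of_real s))) (at z)"
      unfolding divide_inverse
      by (intro has_derivative_minus has_derivative_mult_left has_derivative_mult
          has_derivative_ident bounded_linear.has_derivative[OF bounded_linear_cnj])
    from has_derivative_compose[OF this DERIV_exp[THEN has_field_derivative_imp_has_derivative]]
    show ?thesis .
  qed
  then show ?thesis
    unfolding has_wirtinger_def eq
    by (rule has_derivative_eq_rhs[rotated, THEN allI, rotated]) (simp add: fun_eq_iff algebra_simps add_divide_distrib)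
qed

text \<open>The derivative of \<open>gauss_fun s\<close> with respect to the conjugate variable is
  \<open>- z / s\<close> times itself. So the product rule splits the same derivative of
  \<open>gauss_fun s * f\<close>, whose integral is 0, into the two integrals compared here.\<close>

lemma gauss_integration_by_parts:
  assumes f: "has_wirtinger f p q" and sub: "subgaussian f" "subgaussian p" "subgaussian q"
    and s: "0 < s"
  shows "(\<integral>y. gauss_fun s y * (y * f y) \<partial>lborel) = of_real s * (\<integral>y. gauss_fun s y * q y \<partial>lborel)"
proof -
  let ?P = "\<lambda>z. gauss_fun s z * (- cnj z / of_real s) * f z + gauss_fun s z * p z"
  let ?Q = "\<lambda>z. gauss_fun s z * (- z / of_real s) * f z + gauss_fun s z * q z"
  let ?P' = "\<lambda>z. (- 1 / of_real s) * cnj z * f z + p z"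
  let ?Q' = "\<lambda>z. (- 1 / of_real s) * z * f z + q z"
  have W: "has_wirtinger (\<lambda>z. gauss_fun s z * f z) ?P ?Q"
    by (rule has_wirtinger_mult[OF has_wirtinger_gauss_fun[OF s] f])
  have eq: "?P = (\<lambda>z. gauss_fun s z * ?P' z)" "?Q = (\<lambda>z. gauss_fun s z * ?Q' z)"
    by (simp_all add: fun_eq_iff field_simps)
  have sP: "subgaussian ?P'" and sQ: "subgaussian ?Q'"
    by (intro subgaussian_add subgaussian_mult subgaussian_const subgaussian_cnj subgaussian_ident sub)+
  obtain C where C: "C \<ge> 0" "\<And>y. cmod (gauss_fun s y * f y) \<le> C * exp (- ((cmod y)\<^sup>2 / (2 * s)))"
    using subgaussian_gauss_bound[OF sub(1) s] by metis
  have Q0: "integral\<^sup>L lborel ?Q = 0"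
  proof (rule integral_wirtinger_bar_eq_0[OF W, of "2 * s" C])
    show "continuous_on UNIV ?P" "continuous_on UNIV ?Q" unfolding eq
      by (intro continuous_intros s subgaussian_continuous_on sP sQ)+
    show "integrable lborel ?P" "integrable lborel ?Q" unfolding eq
      by (intro integrable_gauss_subgaussian sP sQ s)+
  qed (use C s in auto)
  have Q: "?Q = (\<lambda>z. (- 1 / of_real s) * (gauss_fun s z * (z * f z)) + gauss_fun s z * q z)"
    by (simp add: fun_eq_iff field_simps)
  define I where "I = (\<integral>z. gauss_fun s z * (z * f z) \<partial>lborel)"
  define K where "K = (\<integral>z. gauss_fun s z * q z \<partial>lborel)"
  have "integral\<^sup>L lborel ?Q = (- 1 / of_real s) * I + K"
    unfolding Q I_def K_def
    by (subst Bochner_Integration.integral_add)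
       (simp_all only: integral_mult_right_zero integrable_mult_right
          integrable_gauss_subgaussian subgaussian_mult subgaussian_ident sub s)
  with Q0 s have "I = of_real s * K"
    by (simp add: field_simps)
  then show ?thesis by (simp only: I_def K_def)
qed

section \<open>Convolution with a centred Gaussian\<close>

definition gauss_conv :: "real \<Rightarrow> (complex \<Rightarrow> complex) \<Rightarrow> complex \<Rightarrow> complex" where
  "gauss_conv s \<phi> w = of_real (1 / (pi * s)) * (\<integral>y. gauss_fun s y * \<phi> (w - y) \<partial>lborel)"

lemma integrable_gauss_conv:
  "subgaussian f \<Longrightarrow> 0 < s \<Longrightarrow> integrable lborel (\<lambda>y. gauss_fun s y * f (w - y))"
  using integrable_gauss_subgaussian[OF subgaussian_translate] .

lemma gauss_conv_const:
  assumes "0 < s" shows "gauss_conv s (\<lambda>_. c) w = c"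
  using assms has_bochner_integral_gauss_complex[OF assms]
  by (simp add: gauss_conv_def gauss_fun_def has_bochner_integral_iff)

lemma gauss_conv_add:
  assumes "subgaussian f" "subgaussian g" "0 < s"
  shows "gauss_conv s (\<lambda>z. f z + g z) w = gauss_conv s f w + gauss_conv s g w"
  using assms by (simp add: gauss_conv_def integrable_gauss_conv distrib_left)

lemma gauss_conv_cmult: "gauss_conv s (\<lambda>z. c * f z) w = c * gauss_conv s f w"
proof -
  have "gauss_fun s y * (c * f (w - y)) = c * (gauss_fun s y * f (w - y))" for y
    by simp
  then show ?thesis unfolding gauss_conv_def by (simp only: integral_mult_right_zero mult.left_commute)
qed

lemma gauss_conv_cnj: "gauss_conv s (\<lambda>z. cnj (f z)) w = cnj (gauss_conv s f w)"
proof -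
  have "gauss_fun s y * cnj (f (w - y)) = cnj (gauss_fun s y * f (w - y))" for y
    by (simp add: gauss_fun_def)
  then show ?thesis unfolding gauss_conv_def by (simp del: complex_cnj_mult) simp
qed

text \<open>Under the integral the factor is \<open>w - y\<close>. Integration by parts removes
  \<open>y\<close>, and the derivative of the reflected function \<open>f (w - y)\<close> is
  \<open>- q (w - y)\<close>, which turns the minus sign into a plus.\<close>

lemma gauss_conv_mult_ident:
  assumes f: "has_wirtinger f p q" and sub: "subgaussian f" "subgaussian p" "subgaussian q"
    and s: "0 < s"
  shows "gauss_conv s (\<lambda>z. z * f z) w = w * gauss_conv s f w + of_real s * gauss_conv s q w"
proof -
  have neg: "subgaussian (\<lambda>z. - g z)" if "subgaussian g" for g
    using subgaussian_mult[OF subgaussian_const[of "-1"] that] by simp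
  let ?g = "gauss_fun s"
  have "(\<integral>y. ?g y * ((w - y) * f (w - y)) \<partial>lborel)
      = (\<integral>y. w * (?g y * f (w - y)) - ?g y * (y * f (w - y)) \<partial>lborel)"
    by (intro Bochner_Integration.integral_cong) (auto simp: algebra_simps)
  also have "\<dots> = w * (\<integral>y. ?g y * f (w - y) \<partial>lborel) - (\<integral>y. ?g y * (y * f (w - y)) \<partial>lborel)"
    by (subst Bochner_Integration.integral_diff)
       (auto intro!: integrable_gauss_subgaussian subgaussian_mult subgaussian_ident
          subgaussian_translate sub s)
  also have "(\<integral>y. ?g y * (y * f (w - y)) \<partial>lborel) = - of_real s * (\<integral>y. ?g y * q (w - y) \<partial>lborel)"
    by (subst gauss_integration_by_parts[OF has_wirtinger_translate[OF f]])
       (auto intro!: neg subgaussian_translate sub s)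
  finally show ?thesis
    by (simp add: gauss_conv_def algebra_simps)
qed

text \<open>Applied to the recursion of \<open>ito\<close>, the multiplication rule contributes
  \<open>s\<close> times the very term that already carries the factor \<open>c\<close>, so
  induction on \<open>m\<close> yields the recursion with \<open>c + s\<close>.\<close>

lemma gauss_conv_ito:
  assumes s: "0 < s"
  shows "gauss_conv s (ito m n c) w = ito m n (c + of_real s) w"
proof -
  have step: "gauss_conv s (\<lambda>z. z * ito m n c z) w = w * gauss_conv s (ito m n c) w
      + of_real s * (of_nat n * gauss_conv s (ito m (n - 1) c) w)" for m n c
    by (subst gauss_conv_mult_ident[OF has_wirtinger_ito])
       (auto intro!: subgaussian_ito subgaussian_mult subgaussian_const s simp: gauss_conv_cmult)
  \<comment> \<open>Holomorphic powers are \<open>ito n 0 0\<close>, for which the derivative term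
    carries the factor \<open>of_nat 0\<close>. Conjugation turns them into the base case of the
    main induction.\<close>
  have z: "gauss_conv s (\<lambda>z. z ^ n) w = w ^ n" for n
  proof (induction n)
    case 0
    show ?case using gauss_conv_const[OF s] by simp
  next
    case (Suc n)
    with step[of n 0 0] show ?case by (simp add: ito_at_0_c[abs_def])
  qed
  show ?thesis
  proof (induction m arbitrary: n)
    case 0
    show ?case
      using gauss_conv_cnj[of s "\<lambda>z. z ^ n" w] by (simp add: ito.simps[abs_def] z)
  next
    case (Suc m)
    have "gauss_conv s (ito (Suc m) n c) w = gauss_conv s (\<lambda>z. z * ito m n c z) w
        + c * of_nat n * gauss_conv s (ito m (n - 1) c) w"
      unfolding ito.simps[abs_def]
      by (subst gauss_conv_add)
         (auto intro!: subgaussian_ito subgaussian_mult subgaussian_const subgaussian_ident s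
           simp: gauss_conv_cmult)
    also have "\<dots> = ito (Suc m) n (c + of_real s) w"
      by (simp add: step Suc algebra_simps)
    finally show ?case .
  qed
qed

subsection \<open>The space of square integrable functions\<close>

lemma L2_norm_eq: "L2_norm M f = sqrt (\<integral>x. (cmod (f x))\<^sup>2 \<partial>M)"
proof -
  have "f x * cnj (f x) = of_real ((cmod (f x))\<^sup>2)" for x
    by (simp only: complex_norm_square)
  then show ?thesis
    unfolding L2_norm_def L2_inner_def by (simp del: of_real_power)
qed

lemma L2_norm_nonneg: "0 \<le> L2_norm M f"
  by (simp add: L2_norm_eq)

lemma L2_norm_power2: "(L2_norm M f)\<^sup>2 = (\<integral>x. (cmod (f x))\<^sup>2 \<partial>M)"
  by (simp add: L2_norm_eq)

lemma L2_norm_cmult: "L2_norm M (\<lambda>x. c * f x) = cmod c * L2_norm M f"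
  by (simp add: L2_norm_eq norm_mult power_mult_distrib real_sqrt_mult)

lemma L2_cmult: "f \<in> L2 M \<Longrightarrow> (\<lambda>x. c * f x) \<in> L2 M"
  by (auto simp: L2_def norm_mult power_mult_distrib)

text \<open>A substitute for the triangle inequality that passes through the integral directly. Its
  factor 2 is why later approximations start from \<open>e / 4\<close>.\<close>

lemma norm_add_power2_le:
  fixes a b :: "'a::real_normed_vector"
  shows "(norm (a + b))\<^sup>2 \<le> 2 * (norm a)\<^sup>2 + 2 * (norm b)\<^sup>2"
proof -
  have "(norm (a + b))\<^sup>2 \<le> (norm a + norm b)\<^sup>2"
    by (intro power_mono norm_triangle_ineq) auto
  also have "\<dots> \<le> 2 * (norm a)\<^sup>2 + 2 * (norm b)\<^sup>2"
    using zero_le_power2[of "norm a - norm b"] by (simp add: power2_eq_square algebra_simps)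
  finally show ?thesis .
qed

lemma L2_add:
  assumes "f \<in> L2 M" "g \<in> L2 M" shows "(\<lambda>x. f x + g x) \<in> L2 M"
proof -
  have "integrable M (\<lambda>x. (cmod (f x + g x))\<^sup>2)"
    by (rule Bochner_Integration.integrable_bound[of _ "\<lambda>x. 2 * (cmod (f x))\<^sup>2 + 2 * (cmod (g x))\<^sup>2"])
       (use assms norm_add_power2_le in \<open>auto simp: L2_def\<close>)
  with assms show ?thesis by (auto simp: L2_def)
qed

lemma L2_diff: "f \<in> L2 M \<Longrightarrow> g \<in> L2 M \<Longrightarrow> (\<lambda>x. f x - g x) \<in> L2 M"
  using L2_add[of f M "\<lambda>x. - 1 * g x"] L2_cmult[of g M "-1"] by simp

lemma L2_norm_add_power2_le:
  assumes "f \<in> L2 M" "g \<in> L2 M"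
  shows "(L2_norm M (\<lambda>x. f x + g x))\<^sup>2 \<le> 2 * (L2_norm M f)\<^sup>2 + 2 * (L2_norm M g)\<^sup>2"
proof -
  have "(\<integral>x. (cmod (f x + g x))\<^sup>2 \<partial>M) \<le> (\<integral>x. 2 * (cmod (f x))\<^sup>2 + 2 * (cmod (g x))\<^sup>2 \<partial>M)"
    using L2_add[OF assms] assms
    by (intro integral_mono norm_add_power2_le) (auto simp: L2_def)
  also have "\<dots> = 2 * (\<integral>x. (cmod (f x))\<^sup>2 \<partial>M) + 2 * (\<integral>x. (cmod (g x))\<^sup>2 \<partial>M)"
    using assms by (auto simp: L2_def)
  finally show ?thesis by (simp add: L2_norm_power2)
qed

lemma L2_integrable_mult_cnj:
  assumes "f \<in> L2 M" "g \<in> L2 M"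
  shows "integrable M (\<lambda>x. f x * cnj (g x))"
proof (rule Bochner_Integration.integrable_bound)
  show "integrable M (\<lambda>x. (cmod (f x))\<^sup>2 + (cmod (g x))\<^sup>2)"
    using assms by (auto simp: L2_def)
  have "a * b \<le> a\<^sup>2 + b\<^sup>2" if "0 \<le> a" "0 \<le> b" for a b :: real
    using zero_le_power2[of "a - b"] mult_nonneg_nonneg[OF that]
    by (simp add: power2_eq_square algebra_simps)
  then show "AE x in M. norm (f x * cnj (g x)) \<le> norm ((cmod (f x))\<^sup>2 + (cmod (g x))\<^sup>2)"
    by (simp add: norm_mult)
  have [measurable]: "f \<in> borel_measurable M" "g \<in> borel_measurable M"
    using assms by (auto simp: L2_def)
  have "(\<lambda>x. cnj (g x)) \<in> borel_measurable M"
    by (intro measurable_compose[OF _ borel_measurable_continuous_onI[of cnj]] continuous_intros) simp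
  then show "(\<lambda>x. f x * cnj (g x)) \<in> borel_measurable M" by measurable
qed

text \<open>Integrating the weighted inequality \<open>2pq|f||g| \<le> p^2|f|^2 + q^2|g|^2\<close>
  leaves the weights free. If both norms are positive, \<open>p = b\<close> and \<open>q = a\<close>
  are optimal.\<close>

lemma L2_Cauchy_Schwarz:
  assumes "f \<in> L2 M" "g \<in> L2 M"
  shows "cmod (L2_inner M f g) \<le> L2_norm M f * L2_norm M g"
proof -
  define a b where "a = L2_norm M f" and "b = L2_norm M g"
  have if': "integrable M (\<lambda>x. (cmod (f x))\<^sup>2)" and ig: "integrable M (\<lambda>x. (cmod (g x))\<^sup>2)"
    using assms by (auto simp: L2_def)
  have *: "2 * p * q * cmod (L2_inner M f g) \<le> (p * a)\<^sup>2 + (q * b)\<^sup>2" if "0 \<le> p" "0 \<le> q" for p q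
  proof -
    have "cmod (L2_inner M f g) \<le> (\<integral>x. cmod (f x) * cmod (g x) \<partial>M)"
      unfolding L2_inner_def by (rule order_trans[OF integral_norm_bound]) (simp add: norm_mult)
    then have "2 * p * q * cmod (L2_inner M f g) \<le> 2 * p * q * (\<integral>x. cmod (f x) * cmod (g x) \<partial>M)"
      using that by (intro mult_left_mono) auto
    also have "\<dots> = (\<integral>x. 2 * p * q * (cmod (f x) * cmod (g x)) \<partial>M)" by simp
    also have "\<dots> \<le> (\<integral>x. p\<^sup>2 * (cmod (f x))\<^sup>2 + q\<^sup>2 * (cmod (g x))\<^sup>2 \<partial>M)"
    proof (rule integral_mono)
      show "integrable M (\<lambda>x. 2 * p * q * (cmod (f x) * cmod (g x)))"
        using integrable_norm[OF L2_integrable_mult_cnj[OF assms]] by (simp add: norm_mult)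
      show "2 * p * q * (cmod (f x) * cmod (g x)) \<le> p\<^sup>2 * (cmod (f x))\<^sup>2 + q\<^sup>2 * (cmod (g x))\<^sup>2" for x
        using zero_le_power2[of "p * cmod (f x) - q * cmod (g x)"]
        by (simp add: power2_eq_square algebra_simps)
    qed (use if' ig in auto)
    also have "\<dots> = (p * a)\<^sup>2 + (q * b)\<^sup>2"
      using if' ig by (simp add: a_def b_def L2_norm_power2 power_mult_distrib)
    finally show ?thesis .
  qed
  have ab: "0 \<le> a" "0 \<le> b" by (simp_all add: a_def b_def L2_norm_nonneg)
  show ?thesis
  proof (cases "a = 0 \<or> b = 0")
    case True
    have "cmod (L2_inner M f g) \<le> 0"
    proof (rule field_le_epsilon)
      fix e :: real assume e: "e > 0"
      \<comment> \<open>With a vanishing norm, the weight of that function may be as large as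
        desired. This \<open>k\<close> makes the remaining square at most \<open>k * e\<close>; the
        summand 1 keeps \<open>k\<close> positive.\<close>
      define k where "k = (a\<^sup>2 + b\<^sup>2 + 1) / e"
      have k: "k > 0" using e by (simp add: k_def add_nonneg_pos)
      have "2 * k * cmod (L2_inner M f g) \<le> a\<^sup>2 + b\<^sup>2"
        using *[of k 1] *[of 1 k] k True by auto
      also have "\<dots> \<le> k * e" using e by (simp add: k_def)
      finally have "k * (2 * cmod (L2_inner M f g)) \<le> k * e" by (simp add: mult_ac)
      with k have "2 * cmod (L2_inner M f g) \<le> e" by (simp only: mult_le_cancel_left_pos)
      then show "cmod (L2_inner M f g) \<le> 0 + e"
        using norm_ge_zero[of "L2_inner M f g"] by linarith
    qed
    then show ?thesis using True by (auto simp: a_def b_def)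
  next
    case False
    then have "0 < a * b" using ab by simp
    have "2 * b * a * cmod (L2_inner M f g) \<le> (b * a)\<^sup>2 + (a * b)\<^sup>2"
      using *[of b a] ab by simp
    then have "(a * b) * cmod (L2_inner M f g) \<le> (a * b) * (a * b)"
      by (simp add: power2_eq_square mult_ac)
    with \<open>0 < a * b\<close> have "cmod (L2_inner M f g) \<le> a * b" by (simp only: mult_le_cancel_left_pos)
    then show ?thesis by (simp add: a_def b_def)
  qed
qed

lemma L2_inner_diff_cmult:
  assumes "f \<in> L2 M" "g \<in> L2 M" "h \<in> L2 M"
  shows "L2_inner M (\<lambda>x. f x - c * g x) h = L2_inner M f h - c * L2_inner M g h"
proof -
  have "L2_inner M (\<lambda>x. f x - c * g x) h = (\<integral>x. f x * cnj (h x) - c * (g x * cnj (h x)) \<partial>M)"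
    unfolding L2_inner_def by (simp add: algebra_simps)
  also have "\<dots> = L2_inner M f h - c * L2_inner M g h"
    unfolding L2_inner_def
    by (subst Bochner_Integration.integral_diff)
       (simp_all only: integral_mult_right_zero integrable_mult_right L2_integrable_mult_cnj assms)
  finally show ?thesis .
qed

lemma L2_inner_self: "L2_inner M f f = of_real ((L2_norm M f)\<^sup>2)"
proof -
  have "L2_inner M f f = (\<integral>x. complex_of_real ((cmod (f x))\<^sup>2) \<partial>M)"
    unfolding L2_inner_def by (simp only: complex_norm_square)
  then show ?thesis by (simp only: L2_norm_power2 integral_complex_of_real)
qed

lemma L2_norm_eq_0_iff:
  assumes "f \<in> L2 M" shows "L2_norm M f = 0 \<longleftrightarrow> (AE x in M. f x = 0)"
  using assms by (simp add: L2_norm_eq L2_def integral_nonneg_eq_0_iff_AE)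

lemma cnj_L2_inner: "cnj (L2_inner M f g) = L2_inner M g f"
  unfolding L2_inner_def Bochner_Integration.integral_cnj[symmetric] by (simp add: mult.commute)

lemma L2_norm_zero: "L2_norm M (\<lambda>_. 0) = 0"
  by (simp add: L2_norm_eq)

subsection \<open>The semigroup and its adjoint\<close>

definition gauss_density :: "real \<Rightarrow> complex \<Rightarrow> real" where
  "gauss_density \<rho> z = 1 / (pi * \<rho>) * exp (- ((cmod z)\<^sup>2 / \<rho>))"

definition gauss_measure :: "real \<Rightarrow> complex measure" where
  "gauss_measure \<rho> = density lborel (\<lambda>z. ennreal (gauss_density \<rho> z))"

lemma ou_measure_eq:
  assumes "r > 0" "\<rho> = 2 * \<sigma>\<^sup>2 / r"
  shows "ou_measure r \<sigma> = gauss_measure \<rho>"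
  using assms
  by (simp add: ou_measure_def gauss_measure_def gauss_density_def cmod_power2 mult_ac)

lemma gauss_density_measurable [measurable]: "gauss_density \<rho> \<in> borel_measurable borel"
  unfolding gauss_density_def[abs_def] by measurable

lemma gauss_density_pos: "\<rho> > 0 \<Longrightarrow> 0 < gauss_density \<rho> z"
  by (simp add: gauss_density_def)

lemma gauss_density_nonneg: "\<rho> > 0 \<Longrightarrow> 0 \<le> gauss_density \<rho> z"
  by (simp add: gauss_density_def)

lemma sets_gauss_measure [simp, measurable_cong]: "sets (gauss_measure \<rho>) = sets borel"
  by (simp add: gauss_measure_def)

lemma space_gauss_measure [simp]: "space (gauss_measure \<rho>) = UNIV"
  by (simp add: gauss_measure_def)

lemma measurable_gauss_measure [simp]: "borel_measurable (gauss_measure \<rho>) = borel_measurable borel"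
  by (rule measurable_cong_sets) simp_all

lemma integrable_gauss_measure_iff:
  fixes f :: "complex \<Rightarrow> 'b::{banach, second_countable_topology}"
  assumes "\<rho> > 0" "f \<in> borel_measurable borel"
  shows "integrable (gauss_measure \<rho>) f \<longleftrightarrow> integrable lborel (\<lambda>z. gauss_density \<rho> z *\<^sub>R f z)"
  unfolding gauss_measure_def using assms
  by (intro integrable_density) (auto simp: gauss_density_nonneg)

lemma integral_gauss_measure:
  fixes f :: "complex \<Rightarrow> 'b::{banach, second_countable_topology}"
  assumes "\<rho> > 0" "f \<in> borel_measurable borel"
  shows "integral\<^sup>L (gauss_measure \<rho>) f = (\<integral>z. gauss_density \<rho> z *\<^sub>R f z \<partial>lborel)"
  unfolding gauss_measure_def using assms
  by (intro integral_density) (auto simp: gauss_density_nonneg)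

lemma AE_gauss_measure_iff:
  assumes "\<rho> > 0"
  shows "(AE z in gauss_measure \<rho>. P z) \<longleftrightarrow> (AE z in lborel. P z)"
  unfolding gauss_measure_def using assms
  by (subst AE_density) (auto simp: gauss_density_pos)

lemma prob_space_gauss_measure:
  assumes "\<rho> > 0" shows "prob_space (gauss_measure \<rho>)"
proof
  have "has_bochner_integral lborel (\<lambda>z. 1 / (pi * \<rho>) * exp (- ((cmod z)\<^sup>2 / \<rho>))) (1 / (pi * \<rho>) * (pi * \<rho>))"
    by (intro has_bochner_integral_mult_right has_bochner_integral_gauss_complex assms)
  then have "has_bochner_integral lborel (gauss_density \<rho>) 1"
    using assms by (simp add: gauss_density_def[abs_def])
  then have "(\<integral>\<^sup>+z. ennreal (gauss_density \<rho> z) \<partial>lborel) = 1"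
    using assms by (simp add: has_bochner_integral_iff nn_integral_eq_integral gauss_density_nonneg)
  then show "emeasure (gauss_measure \<rho>) (space (gauss_measure \<rho>)) = 1"
    by (simp add: gauss_measure_def emeasure_density)
qed

lemma gauss_density_scaleR: "gauss_density \<rho> z *\<^sub>R a = of_real (1 / (pi * \<rho>)) * (gauss_fun \<rho> z * a)"
  by (simp add: gauss_density_def gauss_fun_def scaleR_conv_of_real)

lemma integrable_gauss_measure_subgaussian:
  assumes "\<rho> > 0" "subgaussian f"
  shows "integrable (gauss_measure \<rho>) f"
  using assms
  by (simp add: integrable_gauss_measure_iff subgaussian_measurable gauss_density_scaleR
      integrable_gauss_subgaussian)

lemma subgaussian_L2:
  assumes "\<rho> > 0" "subgaussian f"
  shows "f \<in> L2 (gauss_measure \<rho>)"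
proof -
  have "integrable (gauss_measure \<rho>) (\<lambda>z. f z * cnj (f z))"
    by (intro integrable_gauss_measure_subgaussian subgaussian_mult subgaussian_cnj assms)
  then have "integrable (gauss_measure \<rho>) (\<lambda>z. complex_of_real ((cmod (f z))\<^sup>2))"
    by (simp only: complex_norm_square)
  then show ?thesis
    using assms by (simp add: L2_def subgaussian_measurable complex_of_real_integrable_eq del: of_real_power)
qed

text \<open>The integrand is \<open>ito n n 0\<close>, and integrating an even function against the
  Gaussian is evaluating its convolution at 0. There the recursion of \<open>ito n n \<rho>\<close>
  retains only the term with \<open>c\<close>, giving \<open>\<rho>^n * n!\<close>.\<close>

lemma gauss_measure_moment:
  assumes "\<rho> > 0"
  shows "has_bochner_integral (gauss_measure \<rho>) (\<lambda>z. (cmod z) ^ (2 * n)) (\<rho> ^ n * fact n)"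
proof -
  let ?f = "\<lambda>z::complex. complex_of_real (cmod z ^ (2 * n))"
  have eq: "?f = ito n n 0"
  proof
    fix z
    have "?f z = (complex_of_real ((cmod z)\<^sup>2)) ^ n"
      by (simp add: power_mult)
    also have "\<dots> = ito n n 0 z"
      by (simp only: complex_norm_square power_mult_distrib ito_at_0_c)
    finally show "?f z = ito n n 0 z" .
  qed
  have "integral\<^sup>L (gauss_measure \<rho>) ?f = gauss_conv \<rho> ?f 0"
    by (subst integral_gauss_measure[OF assms], measurable)
       (simp only: gauss_density_scaleR integral_mult_right_zero gauss_conv_def diff_0 norm_minus_cancel)
  also have "\<dots> = ito n n (of_real \<rho>) 0"
    unfolding eq using gauss_conv_ito[OF assms, of n n 0 0] by simp
  also have "\<dots> = of_real (\<rho> ^ n * fact n)"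
    by (induction n) (simp_all add: algebra_simps)
  finally have 1: "integral\<^sup>L (gauss_measure \<rho>) (\<lambda>z. cmod z ^ (2 * n)) = \<rho> ^ n * fact n"
    by (simp only: integral_complex_of_real of_real_eq_iff)
  have "integrable (gauss_measure \<rho>) ?f"
    unfolding eq by (intro integrable_gauss_measure_subgaussian assms subgaussian_ito)
  with 1 show ?thesis
    by (simp add: has_bochner_integral_iff complex_of_real_integrable_eq del: of_real_power)
qed

lemma lborel_distr_reflect: "distr lborel borel (\<lambda>x. c - x) = (lborel :: complex measure)"
proof -
  have "(lborel :: complex measure) = density (distr lborel borel (\<lambda>x. c + (-1) *\<^sub>R x)) (\<lambda>_. 1)"
    using lborel_affine[of "-1" c] by simp
  then show ?thesis by (simp add: density_1)
qed

lemma integral_lborel_reflect: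
  fixes f :: "complex \<Rightarrow> 'b::{banach, second_countable_topology}"
  assumes "f \<in> borel_measurable borel"
  shows "(\<integral>y. f (c - y) \<partial>lborel) = (\<integral>y. f y \<partial>lborel)"
  by (subst (2) lborel_distr_reflect[of c, symmetric]) (use assms in \<open>simp add: integral_distr\<close>)

lemma integrable_lborel_reflect:
  fixes f :: "complex \<Rightarrow> 'b::{banach, second_countable_topology}"
  assumes "f \<in> borel_measurable borel"
  shows "integrable lborel (\<lambda>y. f (c - y)) \<longleftrightarrow> integrable lborel f"
  by (subst (2) lborel_distr_reflect[of c, symmetric]) (use assms in \<open>simp add: integrable_distr_eq\<close>)

section \<open>The flow and the action of the semigroup on polynomials\<close>

lemma ou_drift_eq: "ou_drift r \<Omega> z = - (of_real r + \<i> * of_real \<Omega>) * z"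
  by (simp add: ou_drift_def complex_eq_iff)

lemma ou_flow_eq: "ou_flow r \<Omega> t z = exp (- (of_real t * (of_real r + \<i> * of_real \<Omega>))) * z"
proof -
  let ?a = "of_real r + \<i> * of_real \<Omega> :: complex"
  have "(ou_drift r \<Omega> ^^ k) z = (- ?a) ^ k * z" for k
    by (induction k) (simp_all add: ou_drift_eq algebra_simps)
  moreover have "(- (of_real t * ?a)) ^ k = of_real (t ^ k) * (- ?a) ^ k" for k
    by (metis mult_minus_right of_real_power power_mult_distrib)
  ultimately have "(t ^ k / fact k) *\<^sub>R (ou_drift r \<Omega> ^^ k) z = (- (of_real t * ?a)) ^ k /\<^sub>R fact k * z" for k
    by (simp only: scaleR_conv_of_real of_real_divide of_real_mult of_real_inverse divide_inverse mult_ac)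
  moreover have "(\<lambda>k. (- (of_real t * ?a)) ^ k /\<^sub>R fact k * z) sums (exp (- (of_real t * ?a)) * z)"
    by (intro sums_mult2 exp_converges)
  ultimately show ?thesis
    unfolding ou_flow_def by (simp add: sums_iff)
qed

lemma ou_semigroup_eq:
  "ou_semigroup r \<Omega> \<rho> t \<phi> x = gauss_conv (\<rho> * (1 - exp (- 2 * r * t))) \<phi> (ou_flow r \<Omega> t x)"
  by (simp add: ou_semigroup_def gauss_conv_def gauss_fun_def mult.assoc)

lemma ou_variance_pos:
  fixes \<rho> r t :: real
  assumes "\<rho> > 0" "r > 0" "t > 0"
  shows "0 < \<rho> * (1 - exp (- 2 * r * t))"
  using assms by simp

lemma ou_semigroup_ito:
  assumes "\<rho> > 0" "r > 0" "t > 0"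
  shows "ou_semigroup r \<Omega> \<rho> t (ito m n (of_real (- \<rho>))) x
    = exp (ou_eigenvalue r \<Omega> m n * of_real t) * ito m n (of_real (- \<rho>)) x"
proof -
  define p where "p = exp (- (of_real t * (of_real r + \<i> * of_real \<Omega>)))"
  have cp: "cnj p = exp (- (of_real t * (of_real r - \<i> * of_real \<Omega>)))"
    by (simp add: p_def exp_cnj)
  have pq: "p * cnj p = exp (- 2 * r * t)"
    unfolding cp unfolding p_def exp_add[symmetric] exp_of_real[symmetric]
    by (rule arg_cong[of _ _ exp]) (simp add: algebra_simps)
  have "ou_semigroup r \<Omega> \<rho> t (ito m n (of_real (- \<rho>))) x =
      ito m n (of_real (- \<rho>) + of_real (\<rho> * (1 - exp (- 2 * r * t)))) (p * x)"
    unfolding ou_semigroup_eq gauss_conv_ito[OF ou_variance_pos[OF assms]] ou_flow_eq p_def ..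
  \<comment> \<open>The convolution shrinks the parameter to \<open>-\<rho> * |p|^2\<close>, exactly
    the one that homogeneity relates to \<open>-\<rho>\<close>. The powers of \<open>p\<close> then
    come out as the eigenvalue.\<close>
  also have "of_real (- \<rho>) + of_real (\<rho> * (1 - exp (- 2 * r * t))) = p * cnj p * of_real (- \<rho>)"
    unfolding pq by (simp add: algebra_simps)
  also have "ito m n (p * cnj p * of_real (- \<rho>)) (p * x) = p ^ m * cnj p ^ n * ito m n (of_real (- \<rho>)) x"
    by (rule ito_scale) auto
  also have "p ^ m * cnj p ^ n = exp (ou_eigenvalue r \<Omega> m n * of_real t)"
    unfolding cp unfolding p_def exp_of_nat_mult[symmetric] exp_add[symmetric]
    by (rule arg_cong[of _ _ exp]) (simp add: ou_eigenvalue_def algebra_simps)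
  finally show ?thesis .
qed

lemma ou_semigroup_measurable:
  assumes [measurable]: "f \<in> borel_measurable borel"
  shows "ou_semigroup r \<Omega> \<rho> t f \<in> borel_measurable borel"
proof -
  have [measurable]: "ou_flow r \<Omega> t \<in> borel_measurable borel"
    unfolding ou_flow_eq[abs_def] by measurable
  show ?thesis
    unfolding ou_semigroup_eq[abs_def] gauss_conv_def[abs_def] by measurable
qed

section \<open>The Mehler kernel and the adjoint semigroup\<close>

text \<open>The joint density of the stationary Ornstein-Uhlenbeck process at times 0 and
  \<open>t\<close>. Including the weight of \<open>x\<close> is what makes the reversal symmetry
  exact.\<close>

definition mehler :: "real \<Rightarrow> real \<Rightarrow> real \<Rightarrow> real \<Rightarrow> complex \<Rightarrow> complex \<Rightarrow> real" where
  "mehler r \<Omega> \<rho> t x w =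
     gauss_density \<rho> x * gauss_density (\<rho> * (1 - exp (- 2 * r * t))) (ou_flow r \<Omega> t x - w)"

text \<open>The time reversal of the Ornstein-Uhlenbeck process rotates in the opposite direction.\<close>

lemma mehler_swap:
  assumes "\<rho> > 0" "r > 0" "t > 0"
  shows "mehler r \<Omega> \<rho> t x w = mehler r (- \<Omega>) \<rho> t w x"
proof -
  define q where "q = exp (- 2 * r * t)"
  have q: "0 < 1 - q" using assms by (simp add: q_def)
  define p where "p = exp (- (of_real t * (of_real r + \<i> * of_real \<Omega>)))"
  have cp: "exp (- (of_real t * (of_real r + \<i> * of_real (- \<Omega>)))) = cnj p"
    by (simp add: p_def exp_cnj)
  have np: "(cmod p)\<^sup>2 = q"
    by (simp add: p_def q_def norm_exp_eq_Re power2_eq_square flip: exp_add)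
  have d: "(cmod (a - b))\<^sup>2 = (cmod a)\<^sup>2 + (cmod b)\<^sup>2 - 2 * Re (a * cnj b)" for a b
    unfolding cmod_power2 by (simp add: power2_eq_square algebra_simps)
  \<comment> \<open>As \<open>1/\<rho> + q/(\<rho>(1-q)) = 1/(\<rho>(1-q))\<close>, both sides equal
    \<open>|x|^2 + |w|^2 - 2 Re (p x cnj w)\<close> divided by \<open>\<rho>(1-q)\<close>.\<close>
  have eq: "(cmod x)\<^sup>2 / \<rho> + (cmod (p * x - w))\<^sup>2 / (\<rho> * (1 - q))
      = (cmod w)\<^sup>2 / \<rho> + (cmod (cnj p * w - x))\<^sup>2 / (\<rho> * (1 - q))"
    unfolding d norm_mult power_mult_distrib complex_mod_cnj np
    using assms(1) q by (simp add: divide_simps) (simp add: algebra_simps)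
  have flow: "ou_flow r \<Omega> t x = p * x" "ou_flow r (- \<Omega>) t w = cnj p * w"
    by (simp_all only: ou_flow_eq cp flip: p_def)
  have e: "1 / (pi * \<rho>) * exp (- u) * (1 / (pi * s) * exp (- v)) = 1 / (pi * \<rho>) * (1 / (pi * s)) * exp (- (u + v))"
    for u v s :: real
    by (simp add: exp_add exp_diff exp_minus divide_inverse)
  show ?thesis
    unfolding mehler_def gauss_density_def flow q_def[symmetric] e eq ..
qed

lemma mehler_measurable [measurable]:
  "case_prod (mehler r \<Omega> \<rho> t) \<in> borel_measurable (lborel \<Otimes>\<^sub>M lborel)"
  unfolding mehler_def[abs_def] ou_flow_eq case_prod_unfold by measurable

lemma mehler_nonneg:
  assumes "\<rho> > 0" "r > 0" "t > 0"
  shows "0 \<le> mehler r \<Omega> \<rho> t x w"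
  unfolding mehler_def
  by (intro mult_nonneg_nonneg gauss_density_nonneg ou_variance_pos assms)

text \<open>The first marginal of the joint density. With \<open>mehler_swap\<close> the second
  marginal is the same Gaussian, which expresses the invariance of the measure.\<close>

lemma has_bochner_integral_mehler:
  assumes "\<rho> > 0" "r > 0" "t > 0"
  shows "has_bochner_integral lborel (mehler r \<Omega> \<rho> t x) (gauss_density \<rho> x)"
proof -
  let ?s = "\<rho> * (1 - exp (- 2 * r * t))"
  have s: "?s > 0" by (rule ou_variance_pos[OF assms])
  have "has_bochner_integral lborel (\<lambda>z. 1 / (pi * ?s) * exp (- ((cmod z)\<^sup>2 / ?s))) (1 / (pi * ?s) * (pi * ?s))"
    by (intro has_bochner_integral_mult_right has_bochner_integral_gauss_complex s)
  also have "1 / (pi * ?s) * (pi * ?s) = 1"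
    by (rule nonzero_divide_eq_eq[THEN iffD1, OF _ refl, symmetric])
       (use mult_pos_pos[OF pi_gt_zero s] in \<open>rule less_imp_neq[symmetric]\<close>)
  finally have "has_bochner_integral lborel (gauss_density ?s) 1"
    by (simp add: gauss_density_def[abs_def])
  then have "has_bochner_integral lborel (\<lambda>w. gauss_density ?s (ou_flow r \<Omega> t x - w)) 1"
    by (simp add: has_bochner_integral_iff integral_lborel_reflect integrable_lborel_reflect)
  from has_bochner_integral_mult_right[OF this, of "gauss_density \<rho> x"] show ?thesis
    by (simp add: mehler_def[abs_def])
qed

lemma integrable_mehler_fst:
  fixes h :: "complex \<Rightarrow> real"
  assumes "\<rho> > 0" "r > 0" "t > 0" and h: "integrable (gauss_measure \<rho>) h"
  shows "integrable (lborel \<Otimes>\<^sub>M lborel) (\<lambda>(x, w). mehler r \<Omega> \<rho> t x w * h x)"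
proof (rule lborel_pair.Fubini_integrable)
  note m = has_bochner_integral_mehler[OF assms(1-3), of \<Omega>]
  have [measurable]: "h \<in> borel_measurable borel"
    using borel_measurable_integrable[OF h] by simp
  show "(\<lambda>(x, w). mehler r \<Omega> \<rho> t x w * h x) \<in> borel_measurable (lborel \<Otimes>\<^sub>M lborel)"
    by measurable
  show "AE x in lborel. integrable lborel (\<lambda>w. case (x, w) of (x, w) \<Rightarrow> mehler r \<Omega> \<rho> t x w * h x)"
    using m by (simp add: has_bochner_integral_iff)
  have "integrable lborel (\<lambda>x. gauss_density \<rho> x * \<bar>h x\<bar>)"
    using h assms(1) integrable_gauss_measure_iff[of \<rho> "\<lambda>x. \<bar>h x\<bar>"] by simp
  then show "integrable lborel (\<lambda>x. \<integral>w. norm (case (x, w) of (x, w) \<Rightarrow> mehler r \<Omega> \<rho> t x w * h x) \<partial>lborel)"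
    using m assms(1-3) by (simp add: has_bochner_integral_iff abs_mult mehler_nonneg)
qed

lemma integrable_mehler_snd:
  fixes h :: "complex \<Rightarrow> real"
  assumes "\<rho> > 0" "r > 0" "t > 0" and h: "integrable (gauss_measure \<rho>) h"
  shows "integrable (lborel \<Otimes>\<^sub>M lborel) (\<lambda>(x, w). mehler r \<Omega> \<rho> t x w * h w)"
  using lborel_pair.integrable_product_swap[OF integrable_mehler_fst[OF assms, of "- \<Omega>"]]
  by (simp add: mehler_swap[OF assms(1-3), of \<Omega>])

lemma ou_semigroup_mehler:
  assumes "\<rho> > 0" "r > 0" "t > 0" and [measurable]: "f \<in> borel_measurable borel"
  shows "gauss_density \<rho> x *\<^sub>R ou_semigroup r \<Omega> \<rho> t f x
    = (\<integral>w. of_real (mehler r \<Omega> \<rho> t x w) * f w \<partial>lborel)"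
proof -
  let ?s = "\<rho> * (1 - exp (- 2 * r * t))" and ?u = "ou_flow r \<Omega> t x"
  let ?h = "\<lambda>w. of_real (gauss_density ?s (?u - w)) * f w"
  have "ou_semigroup r \<Omega> \<rho> t f x = (\<integral>y. ?h (?u - y) \<partial>lborel)"
    unfolding ou_semigroup_eq gauss_conv_def integral_mult_right_zero[symmetric]
    by (intro Bochner_Integration.integral_cong) (auto simp: gauss_density_def gauss_fun_def)
  also have "\<dots> = (\<integral>w. ?h w \<partial>lborel)"
    by (rule integral_lborel_reflect) measurable
  finally show ?thesis
    by (simp add: mehler_def scaleR_conv_of_real mult.assoc)
qed

text \<open>Both inner products are double integrals of \<open>f w * cnj (g x)\<close> against the
  Mehler kernel, in opposite orders. Fubini applies because this product is bounded by
  \<open>|f w|^2 + |g x|^2\<close>, which is integrable against the kernel since both marginals are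
  the Gaussian.\<close>

lemma ou_semigroup_adjoint:
  assumes pos: "\<rho> > 0" "r > 0" "t > 0"
    and f: "f \<in> L2 (gauss_measure \<rho>)" and g: "g \<in> L2 (gauss_measure \<rho>)"
  shows "L2_inner (gauss_measure \<rho>) (ou_semigroup r \<Omega> \<rho> t f) g
    = L2_inner (gauss_measure \<rho>) f (ou_semigroup r (- \<Omega>) \<rho> t g)"
proof -
  let ?M = "gauss_measure \<rho>" and ?K = "mehler r \<Omega> \<rho> t"
  have [measurable]: "f \<in> borel_measurable borel" "g \<in> borel_measurable borel"
    using f g by (auto simp: L2_def)
  note [measurable] = ou_semigroup_measurable
  have [measurable]: "cnj \<in> borel_measurable borel"
    by (intro borel_measurable_continuous_onI continuous_intros)
  let ?F = "\<lambda>x w. of_real (?K x w) * (f w * cnj (g x))"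
  have int: "integrable (lborel \<Otimes>\<^sub>M lborel) (\<lambda>(x, w). ?F x w)"
  proof (rule Bochner_Integration.integrable_bound)
    show "integrable (lborel \<Otimes>\<^sub>M lborel)
        (\<lambda>p. (case p of (x, w) \<Rightarrow> ?K x w * (cmod (f w))\<^sup>2) + (case p of (x, w) \<Rightarrow> ?K x w * (cmod (g x))\<^sup>2))"
      using f g by (intro Bochner_Integration.integrable_add integrable_mehler_fst integrable_mehler_snd pos)
        (auto simp: L2_def)
    have "a * b \<le> a\<^sup>2 + b\<^sup>2" if "0 \<le> a" "0 \<le> b" for a b :: real
      using zero_le_power2[of "a - b"] mult_nonneg_nonneg[OF that]
      by (simp add: power2_eq_square algebra_simps)
    then have "cmod (?F x w) \<le> ?K x w * ((cmod (f w))\<^sup>2 + (cmod (g x))\<^sup>2)" for x w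
      using mehler_nonneg[OF pos, of \<Omega> x w]
      by (auto simp: norm_mult intro!: mult_left_mono)
    then show "AE p in lborel \<Otimes>\<^sub>M lborel. norm (case p of (x, w) \<Rightarrow> ?F x w) \<le>
        norm ((case p of (x, w) \<Rightarrow> ?K x w * (cmod (f w))\<^sup>2) + (case p of (x, w) \<Rightarrow> ?K x w * (cmod (g x))\<^sup>2))"
      using mehler_nonneg[OF pos] by (auto simp: distrib_left intro!: AE_I2)
    show "(\<lambda>(x, w). ?F x w) \<in> borel_measurable (lborel \<Otimes>\<^sub>M lborel)"
      by measurable
  qed
  have "L2_inner ?M (ou_semigroup r \<Omega> \<rho> t f) g
      = (\<integral>x. (gauss_density \<rho> x *\<^sub>R ou_semigroup r \<Omega> \<rho> t f x) * cnj (g x) \<partial>lborel)"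
    unfolding L2_inner_def using pos(1) by (subst integral_gauss_measure) auto
  also have "\<dots> = (\<integral>x. (\<integral>w. ?F x w \<partial>lborel) \<partial>lborel)"
    by (intro Bochner_Integration.integral_cong refl)
       (simp add: ou_semigroup_mehler[OF pos] mult.assoc flip: integral_mult_left_zero)
  also have "\<dots> = (\<integral>w. (\<integral>x. ?F x w \<partial>lborel) \<partial>lborel)"
    by (rule lborel_pair.Fubini_integral[OF int, symmetric])
  also have "\<dots> = (\<integral>w. f w * cnj (\<integral>x. of_real (mehler r (- \<Omega>) \<rho> t w x) * g x \<partial>lborel) \<partial>lborel)"
  proof (intro Bochner_Integration.integral_cong refl)
    fix w
    have "(\<integral>x. ?F x w \<partial>lborel) = (\<integral>x. f w * cnj (of_real (mehler r (- \<Omega>) \<rho> t w x) * g x) \<partial>lborel)"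
      by (intro Bochner_Integration.integral_cong refl) (simp add: mehler_swap[OF pos, of \<Omega>])
    then show "(\<integral>x. ?F x w \<partial>lborel) = f w * cnj (\<integral>x. of_real (mehler r (- \<Omega>) \<rho> t w x) * g x \<partial>lborel)"
      by (simp only: integral_mult_right_zero Bochner_Integration.integral_cnj)
  qed
  also have "\<dots> = (\<integral>w. gauss_density \<rho> w *\<^sub>R (f w * cnj (ou_semigroup r (- \<Omega>) \<rho> t g w)) \<partial>lborel)"
    by (simp add: flip: ou_semigroup_mehler[OF pos])
  also have "\<dots> = L2_inner ?M f (ou_semigroup r (- \<Omega>) \<rho> t g)"
    unfolding L2_inner_def using pos(1) by (subst integral_gauss_measure) auto
  finally show ?thesis .
qed

section \<open>Eigenfunctions of the generator and orthogonality\<close>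

lemma tendsto_exp_difference_quotient:
  "((\<lambda>t. (exp (lam * of_real t) - 1) / of_real t) \<longlongrightarrow> (lam::complex)) (at_right 0)"
proof -
  have "((\<lambda>z. exp (lam * z)) has_field_derivative lam) (at 0)"
    by (auto intro!: derivative_eq_intros)
  then have *: "((\<lambda>z. (exp (lam * z) - 1) / z) \<longlongrightarrow> lam) (at 0)"
    by (simp add: DERIV_def)
  have "filterlim complex_of_real (at 0) (at_right 0)"
    unfolding filterlim_at
    by (auto intro!: tendsto_eq_intros simp: eventually_at_filter)
  from filterlim_compose[OF * this] show ?thesis .
qed

text \<open>On \<open>?J\<close> the semigroup is multiplication by a scalar, so the error in the
  definition of the generator is a scalar times the norm of \<open>?J\<close>, and the scalar tends
  to 0.\<close>

lemma eigenfunction_ito: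
  assumes "\<rho> > 0" "r > 0" and A: "A = generator (gauss_measure \<rho>) (ou_semigroup r \<Omega> \<rho>)"
  shows "eigenfunction (gauss_measure \<rho>) A (ou_eigenvalue r \<Omega> m n) (ito m n (of_real (- \<rho>)))"
proof -
  let ?J = "ito m n (of_real (- \<rho>))" and ?l = "ou_eigenvalue r \<Omega> m n" and ?M = "gauss_measure \<rho>"
  have J: "?J \<in> L2 ?M" by (intro subgaussian_L2 subgaussian_ito assms)
  note P = ou_semigroup_ito[OF assms(1,2)]
  have "\<not> (AE x in ?M. ?J x = 0)"
  proof
    assume "AE x in ?M. ?J x = 0"
    then have 0: "AE x in lborel. ?J x = 0" using assms by (simp add: AE_gauss_measure_iff)
    \<comment> \<open>If \<open>?J\<close> vanished almost everywhere, so would its reflection, and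
      hence its convolution at 1. But convolving with parameter \<open>\<rho>\<close> turns
      \<open>?J\<close> into \<open>z^m * cnj z^n\<close>, which is 1 there.\<close>
    have "AE x in distr lborel borel (\<lambda>x. 1 - x). ?J x = 0"
      unfolding lborel_distr_reflect by (rule 0)
    then have "AE y in lborel. ?J (1 - y) = 0"
      by (rule AE_distrD[rotated]) simp
    then have "gauss_conv \<rho> ?J 1 = 0"
      unfolding gauss_conv_def by (auto intro!: integral_eq_zero_AE elim!: AE_mp)
    moreover have "gauss_conv \<rho> ?J 1 = 1"
      using assms by (simp add: gauss_conv_ito)
    ultimately show False by simp
  qed
  moreover have "(?J, \<lambda>x. ?l * ?J x) \<in> A"
    unfolding A generator_def mem_Collect_eq prod.case
  proof (intro conjI allI impI J L2_cmult)
    fix t :: real assume "0 < t"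
    then have "ou_semigroup r \<Omega> \<rho> t ?J = (\<lambda>x. exp (?l * of_real t) * ?J x)"
      using P by auto
    then show "ou_semigroup r \<Omega> \<rho> t ?J \<in> L2 ?M"
      using L2_cmult[OF J] by simp
  next
    have "((\<lambda>t. cmod ((exp (?l * of_real t) - 1) / of_real t - ?l) * L2_norm ?M ?J) \<longlongrightarrow> cmod (?l - ?l) * L2_norm ?M ?J) (at_right 0)"
      by (intro tendsto_intros tendsto_exp_difference_quotient)
    then have "((\<lambda>t. cmod ((exp (?l * of_real t) - 1) / of_real t - ?l) * L2_norm ?M ?J) \<longlongrightarrow> 0) (at_right 0)"
      by simp
    moreover have "\<forall>\<^sub>F t in at_right 0. cmod ((exp (?l * of_real t) - 1) / of_real t - ?l) * L2_norm ?M ?J =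
      L2_norm ?M (\<lambda>x. (ou_semigroup r \<Omega> \<rho> t ?J x - ?J x) / of_real t - ?l * ?J x)"
      using eventually_at_right_less[of 0]
    proof eventually_elim
      case (elim t)
      have "(\<lambda>x. (ou_semigroup r \<Omega> \<rho> t ?J x - ?J x) / of_real t - ?l * ?J x)
        = (\<lambda>x. ((exp (?l * of_real t) - 1) / of_real t - ?l) * ?J x)"
        by (simp only: P[OF elim] fun_eq_iff) (simp add: field_simps)
      then show ?case by (simp only: L2_norm_cmult)
    qed
    ultimately show "((\<lambda>t. L2_norm ?M (\<lambda>x. (ou_semigroup r \<Omega> \<rho> t ?J x - ?J x) / of_real t - ?l * ?J x)) \<longlongrightarrow> 0) (at_right 0)"
      by (rule Lim_transform_eventually)
  qed
  ultimately show ?thesis using J by (simp add: eigenfunction_def)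
qed

text \<open>The defect \<open>?D t\<close> of the difference quotient tends to 0 in norm, hence so
  does its inner product with \<open>?J\<close>. Moving the semigroup to \<open>?J\<close> evaluates
  the same limit as \<open>(?l - lam)\<close> times the coefficient of \<open>f\<close>.\<close>

lemma eigenfunction_coefficient:
  assumes "\<rho> > 0" "r > 0" and A: "A = generator (gauss_measure \<rho>) (ou_semigroup r \<Omega> \<rho>)"
    and f: "eigenfunction (gauss_measure \<rho>) A lam f"
  shows "lam = ou_eigenvalue r \<Omega> m n \<or> L2_inner (gauss_measure \<rho>) f (ito m n (of_real (- \<rho>))) = 0"
proof -
  let ?J = "ito m n (of_real (- \<rho>))" and ?l = "ou_eigenvalue r \<Omega> m n" and ?M = "gauss_measure \<rho>"
  let ?P = "ou_semigroup r \<Omega> \<rho>"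
  let ?D = "\<lambda>t x. (?P t f x - f x) / of_real t - lam * f x"
  have J: "?J \<in> L2 ?M" by (intro subgaussian_L2 subgaussian_ito assms)
  have fL: "f \<in> L2 ?M" and Pf: "\<And>t. t > 0 \<Longrightarrow> ?P t f \<in> L2 ?M"
    and lim: "((\<lambda>t. L2_norm ?M (?D t)) \<longlongrightarrow> 0) (at_right 0)"
    using f by (auto simp: eigenfunction_def A generator_def)
  have D: "L2_inner ?M (?D t) ?J = ((exp (?l * of_real t) - 1) / of_real t - lam) * L2_inner ?M f ?J"
    and DL: "?D t \<in> L2 ?M" if t: "t > 0" for t
  proof -
    have "L2_inner ?M (?P t f) ?J = L2_inner ?M f (ou_semigroup r (- \<Omega>) \<rho> t ?J)"
      by (rule ou_semigroup_adjoint[OF assms(1,2) t fL J])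
    \<comment> \<open>Changing the sign of \<open>\<Omega>\<close> conjugates the eigenvalue, and
      the second slot of the inner product conjugates it back.\<close>
    also have "ou_semigroup r (- \<Omega>) \<rho> t ?J = (\<lambda>x. cnj (exp (?l * of_real t)) * ?J x)"
      using ou_semigroup_ito[OF assms(1,2) t, of "- \<Omega>" m n]
      by (simp add: fun_eq_iff ou_eigenvalue_def exp_cnj)
    also have "L2_inner ?M f \<dots> = exp (?l * of_real t) * L2_inner ?M f ?J"
      unfolding L2_inner_def by (simp add: mult_ac flip: integral_mult_right_zero)
    finally have 1: "L2_inner ?M (?P t f) ?J = exp (?l * of_real t) * L2_inner ?M f ?J" .
    have eq: "?D t = (\<lambda>x. (1 / of_real t) * ?P t f x - (1 / of_real t + lam) * f x)"
      by (simp add: fun_eq_iff diff_divide_distrib distrib_right)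
    show "?D t \<in> L2 ?M"
      unfolding eq by (intro L2_diff L2_cmult Pf fL t)
    have "L2_inner ?M (?D t) ?J = (\<integral>x. (1 / of_real t) * (?P t f x * cnj (?J x))
        - (1 / of_real t + lam) * (f x * cnj (?J x)) \<partial>?M)"
      unfolding L2_inner_def eq by (simp add: algebra_simps)
    also have "\<dots> = (1 / of_real t) * L2_inner ?M (?P t f) ?J - (1 / of_real t + lam) * L2_inner ?M f ?J"
      unfolding L2_inner_def
      by (subst Bochner_Integration.integral_diff)
         (simp_all only: integral_mult_right_zero integrable_mult_right L2_integrable_mult_cnj fL J Pf t)
    finally show "L2_inner ?M (?D t) ?J = ((exp (?l * of_real t) - 1) / of_real t - lam) * L2_inner ?M f ?J"
      unfolding 1 by (simp add: diff_divide_distrib algebra_simps)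
  qed
  have ev: "\<forall>\<^sub>F t in at_right 0. (0::real) < t" by (rule eventually_at_right_less)
  have "((\<lambda>t. L2_inner ?M (?D t) ?J) \<longlongrightarrow> 0) (at_right 0)"
  proof (rule Lim_null_comparison)
    show "\<forall>\<^sub>F t in at_right 0. norm (L2_inner ?M (?D t) ?J) \<le> L2_norm ?M (?D t) * L2_norm ?M ?J"
      using ev by eventually_elim (intro L2_Cauchy_Schwarz DL J)
    show "((\<lambda>t. L2_norm ?M (?D t) * L2_norm ?M ?J) \<longlongrightarrow> 0) (at_right 0)"
      using tendsto_mult_left_zero[OF lim] .
  qed
  moreover have "((\<lambda>t. L2_inner ?M (?D t) ?J) \<longlongrightarrow> (?l - lam) * L2_inner ?M f ?J) (at_right 0)"
  proof (rule Lim_transform_eventually)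
    show "((\<lambda>t. ((exp (?l * of_real t) - 1) / of_real t - lam) * L2_inner ?M f ?J) \<longlongrightarrow>
        (?l - lam) * L2_inner ?M f ?J) (at_right 0)"
      by (intro tendsto_intros tendsto_exp_difference_quotient)
    show "\<forall>\<^sub>F t in at_right 0. ((exp (?l * of_real t) - 1) / of_real t - lam) * L2_inner ?M f ?J
        = L2_inner ?M (?D t) ?J"
      using ev by eventually_elim (rule D[symmetric])
  qed
  ultimately have "(?l - lam) * L2_inner ?M f ?J = 0"
    using tendsto_unique[OF trivial_limit_at_right_real] by blast
  then show ?thesis by auto
qed

subsection \<open>Spans and closures in \<open>L\<^sup>2\<close>\<close>

inductive_set cspan :: "('a \<Rightarrow> complex) set \<Rightarrow> ('a \<Rightarrow> complex) set" for B where
  zero: "(\<lambda>_. 0) \<in> cspan B"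
| step: "f \<in> cspan B \<Longrightarrow> b \<in> B \<Longrightarrow> (\<lambda>x. f x + c * b x) \<in> cspan B"

lemma cspan_cmult: "f \<in> cspan B \<Longrightarrow> (\<lambda>x. c * f x) \<in> cspan B"
proof (induction rule: cspan.induct)
  case zero
  show ?case using cspan.zero by simp
next
  case (step f b d)
  then show ?case using cspan.step[of "\<lambda>x. c * f x" B b "c * d"] by (simp add: algebra_simps)
qed

lemma cspan_base: "b \<in> B \<Longrightarrow> b \<in> cspan B"
  using cspan.step[OF cspan.zero, of b B 1] by simp

lemma cspan_add:
  assumes "f \<in> cspan B" "g \<in> cspan B" shows "(\<lambda>x. f x + g x) \<in> cspan B"
  using assms(2)
proof (induction rule: cspan.induct)
  case zero
  show ?case using assms(1) by simp
next
  case (step g b c)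
  then show ?case using cspan.step[of "\<lambda>x. f x + g x" B b c] by (simp add: add.assoc)
qed

lemma cspan_sum:
  assumes "\<And>i. i \<in> I \<Longrightarrow> f i \<in> cspan B" shows "(\<lambda>x. \<Sum>i\<in>I. f i x) \<in> cspan B"
  using assms
  by (induction I rule: infinite_finite_induct) (simp_all add: cspan.zero cspan_add)

text \<open>The multiplier \<open>g\<close> lets one induction serve for products of two elements of
  a span and for multiplying polynomials by linear forms.\<close>

lemma cspan_subset:
  assumes "f \<in> cspan B" "\<And>b. b \<in> B \<Longrightarrow> (\<lambda>x. g x * b x) \<in> cspan C"
  shows "(\<lambda>x. g x * f x) \<in> cspan C"
  using assms(1)
proof (induction rule: cspan.induct)
  case zero
  show ?case using cspan.zero by simp
next
  case (step f b c)
  have "(\<lambda>x. g x * f x + c * (g x * b x)) \<in> cspan C"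
    by (intro cspan_add cspan_cmult step assms)
  then show ?case by (simp add: algebra_simps)
qed

lemma cspan_mult:
  assumes "\<And>a b. a \<in> B \<Longrightarrow> b \<in> B \<Longrightarrow> (\<lambda>x. a x * b x) \<in> cspan B"
    and "f \<in> cspan B" "g \<in> cspan B"
  shows "(\<lambda>x. f x * g x) \<in> cspan B"
proof (rule cspan_subset[OF assms(3)])
  fix b assume "b \<in> B"
  then have "(\<lambda>x. b x * f x) \<in> cspan B"
    by (intro cspan_subset[OF assms(2)] assms(1))
  then show "(\<lambda>x. f x * b x) \<in> cspan B" by (simp add: mult.commute)
qed

lemma cspan_explicit:
  assumes "f \<in> cspan B"
  shows "\<exists>F c. finite F \<and> F \<subseteq> B \<and> f = (\<lambda>x. \<Sum>h\<in>F. c h * h x)"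
  using assms
proof (induction rule: cspan.induct)
  case zero
  show ?case by (intro exI[of _ "{}"]) simp
next
  case (step f b d)
  then obtain F c where F: "finite F" "F \<subseteq> B" "f = (\<lambda>x. \<Sum>h\<in>F. c h * h x)" by auto
  \<comment> \<open>The new vector \<open>b\<close> may already lie in \<open>F\<close>; its
    coefficients are then added. Outside \<open>F\<close> the old coefficient function is arbitrary
    and has to be masked.\<close>
  let ?c = "\<lambda>h. (if h \<in> F then c h else 0) + (if h = b then d else 0)"
  have "(\<Sum>h\<in>insert b F. ?c h * h x) = f x + d * b x" for x
  proof -
    have "(\<Sum>h\<in>insert b F. ?c h * h x) = (\<Sum>h\<in>insert b F. if h \<in> F then c h * h x else 0)
        + (\<Sum>h\<in>insert b F. if h = b then d * h x else 0)"
      unfolding sum.distrib[symmetric] by (intro sum.cong) (auto simp: algebra_simps)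
    also have "(\<Sum>h\<in>insert b F. if h \<in> F then c h * h x else 0) = f x"
      unfolding F(3) using F(1) by (intro sum.mono_neutral_cong_right) auto
    also have "(\<Sum>h\<in>insert b F. if h = b then d * h x else 0) = d * b x"
      using F(1) by simp
    finally show ?thesis .
  qed
  then show ?case
    using F step(2) by (intro exI[of _ "insert b F"] exI[of _ ?c]) auto
qed

lemma cspan_L2:
  assumes "f \<in> cspan B" "B \<subseteq> L2 M" shows "f \<in> L2 M"
  using assms(1)
proof (induction rule: cspan.induct)
  case zero
  show ?case by (simp add: L2_def)
next
  case (step f b c)
  then show ?case using assms(2) by (intro L2_add L2_cmult) auto
qed

text \<open>Squared norms are used because the estimates for sums and limits are squared
  ones.\<close>

definition L2_closure :: "'a measure \<Rightarrow> ('a \<Rightarrow> complex) set \<Rightarrow> ('a \<Rightarrow> complex) set" where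
  "L2_closure M B = {f \<in> L2 M. \<forall>e>0. \<exists>p\<in>cspan B. (L2_norm M (\<lambda>x. f x - p x))\<^sup>2 < e}"

lemma L2_closureE:
  assumes "f \<in> L2_closure M B" "e > 0"
  obtains p where "p \<in> cspan B" "(L2_norm M (\<lambda>x. f x - p x))\<^sup>2 < e"
  using assms by (auto simp: L2_closure_def)

lemma L2_closureI_approx:
  assumes B: "B \<subseteq> L2 M" and f: "f \<in> L2 M"
    and approx: "\<And>e. e > 0 \<Longrightarrow> \<exists>g\<in>L2_closure M B. (L2_norm M (\<lambda>x. f x - g x))\<^sup>2 < e"
  shows "f \<in> L2_closure M B"
  unfolding L2_closure_def mem_Collect_eq
proof (intro conjI allI impI f)
  fix e :: real assume "e > 0"
  then obtain g where g: "g \<in> L2_closure M B" "(L2_norm M (\<lambda>x. f x - g x))\<^sup>2 < e / 4"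
    using approx[of "e / 4"] by auto
  obtain p where p: "p \<in> cspan B" "(L2_norm M (\<lambda>x. g x - p x))\<^sup>2 < e / 4"
    using L2_closureE[OF g(1), of "e / 4"] \<open>e > 0\<close> by auto
  have gL: "g \<in> L2 M" using g by (simp add: L2_closure_def)
  have "(L2_norm M (\<lambda>x. (f x - g x) + (g x - p x)))\<^sup>2
      \<le> 2 * (L2_norm M (\<lambda>x. f x - g x))\<^sup>2 + 2 * (L2_norm M (\<lambda>x. g x - p x))\<^sup>2"
    by (intro L2_norm_add_power2_le L2_diff f gL cspan_L2[OF p(1) B])
  with g p have "(L2_norm M (\<lambda>x. f x - p x))\<^sup>2 < e" by simp
  with p show "\<exists>p\<in>cspan B. (L2_norm M (\<lambda>x. f x - p x))\<^sup>2 < e" by blast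
qed

lemma cspan_subset_L2_closure:
  assumes "B \<subseteq> L2 M" shows "cspan B \<subseteq> L2_closure M B"
proof
  fix f assume f: "f \<in> cspan B"
  then have "f \<in> L2 M" by (rule cspan_L2[OF _ assms])
  with f show "f \<in> L2_closure M B"
    by (auto simp: L2_closure_def L2_norm_zero intro!: bexI[of _ f])
qed

lemma L2_closure_add:
  assumes B: "B \<subseteq> L2 M" and f: "f \<in> L2_closure M B" and g: "g \<in> L2_closure M B"
  shows "(\<lambda>x. f x + g x) \<in> L2_closure M B"
  unfolding L2_closure_def mem_Collect_eq
proof (intro conjI allI impI)
  have fL: "f \<in> L2 M" and gL: "g \<in> L2 M" using f g by (simp_all add: L2_closure_def)
  then show "(\<lambda>x. f x + g x) \<in> L2 M" by (rule L2_add)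
  fix e :: real assume "e > 0"
  then have e4: "e / 4 > 0" by simp
  obtain p where p: "p \<in> cspan B" "(L2_norm M (\<lambda>x. f x - p x))\<^sup>2 < e / 4"
    by (rule L2_closureE[OF f e4])
  obtain q where q: "q \<in> cspan B" "(L2_norm M (\<lambda>x. g x - q x))\<^sup>2 < e / 4"
    by (rule L2_closureE[OF g e4])
  have "(L2_norm M (\<lambda>x. (f x - p x) + (g x - q x)))\<^sup>2
      \<le> 2 * (L2_norm M (\<lambda>x. f x - p x))\<^sup>2 + 2 * (L2_norm M (\<lambda>x. g x - q x))\<^sup>2"
    by (intro L2_norm_add_power2_le L2_diff fL gL cspan_L2[OF _ B] p q)
  with p q have "(L2_norm M (\<lambda>x. f x + g x - (p x + q x)))\<^sup>2 < e" by (simp add: algebra_simps)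
  with p q show "\<exists>p\<in>cspan B. (L2_norm M (\<lambda>x. f x + g x - p x))\<^sup>2 < e"
    by (intro bexI[of _ "\<lambda>x. p x + q x"] cspan_add)
qed

lemma L2_closure_zero: "B \<subseteq> L2 M \<Longrightarrow> (\<lambda>_. 0) \<in> L2_closure M B"
  using cspan_subset_L2_closure cspan.zero by blast

lemma L2_closure_cmult:
  assumes B: "B \<subseteq> L2 M" and f: "f \<in> L2_closure M B"
  shows "(\<lambda>x. c * f x) \<in> L2_closure M B"
  unfolding L2_closure_def mem_Collect_eq
proof (intro conjI allI impI)
  have fL: "f \<in> L2 M" using f by (simp add: L2_closure_def)
  then show "(\<lambda>x. c * f x) \<in> L2 M" by (rule L2_cmult)
  fix e :: real assume e: "e > 0"
  \<comment> \<open>The summand 1 avoids dividing by zero when \<open>c = 0\<close>.\<close>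
  define d where "d = (cmod c)\<^sup>2 + 1"
  have d: "d > 0" unfolding d_def by (simp add: add_nonneg_pos)
  obtain p where p: "p \<in> cspan B" "(L2_norm M (\<lambda>x. f x - p x))\<^sup>2 < e / d"
    using e d by (auto intro: L2_closureE[OF f, of "e / d"])
  have "(L2_norm M (\<lambda>x. c * f x - c * p x))\<^sup>2 = (cmod c)\<^sup>2 * (L2_norm M (\<lambda>x. f x - p x))\<^sup>2"
    using L2_norm_cmult[of M c "\<lambda>x. f x - p x"] by (simp add: power_mult_distrib right_diff_distrib)
  also have "\<dots> \<le> d * (L2_norm M (\<lambda>x. f x - p x))\<^sup>2"
    by (intro mult_right_mono) (simp_all add: d_def)
  also have "\<dots> < e"
    using p(2) d by (simp add: field_simps)
  finally show "\<exists>p\<in>cspan B. (L2_norm M (\<lambda>x. c * f x - p x))\<^sup>2 < e"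
    by (intro bexI[of _ "\<lambda>x. c * p x"] cspan_cmult p)
qed

lemma L2_closure_sum:
  assumes B: "B \<subseteq> L2 M" and "\<And>i. i \<in> I \<Longrightarrow> f i \<in> L2_closure M B"
  shows "(\<lambda>x. \<Sum>i\<in>I. f i x) \<in> L2_closure M B"
  using assms(2)
  by (induction I rule: infinite_finite_induct) (simp_all add: L2_closure_add[OF B] L2_closure_zero[OF B])

text \<open>With a square integrable majorant \<open>w\<close>, the squared error is at most
  \<open>4 * w^2\<close>, so dominated convergence turns the pointwise limit into a limit in norm,
  under which the closure is stable.\<close>

lemma L2_closure_dominated_limit:
  fixes w :: "'a \<Rightarrow> real"
  assumes B: "B \<subseteq> L2 M" and F: "\<And>n. F n \<in> L2_closure M B"
    and f: "f \<in> borel_measurable M" and w: "w \<in> borel_measurable M" "integrable M (\<lambda>x. (w x)\<^sup>2)"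
    and lim: "\<And>x. x \<in> space M \<Longrightarrow> (\<lambda>n. F n x) \<longlonglongrightarrow> f x"
    and bnd: "\<And>n x. x \<in> space M \<Longrightarrow> cmod (F n x) \<le> w x"
  shows "f \<in> L2_closure M B"
proof (rule L2_closureI_approx[OF B])
  have FL: "F n \<in> L2 M" for n using F by (simp add: L2_closure_def)
  then have Fm: "F n \<in> borel_measurable M" for n by (simp add: L2_def)
  have fw: "cmod (f x) \<le> w x" if "x \<in> space M" for x
    using bnd[OF that] lim[OF that]
    by (intro tendsto_upperbound[OF tendsto_norm]) auto
  have w0: "0 \<le> w x" if "x \<in> space M" for x
    using fw[OF that] norm_ge_zero order_trans by blast
  have "integrable M (\<lambda>x. (cmod (f x))\<^sup>2)"
    using fw f w by (intro Bochner_Integration.integrable_bound[OF w(2)]) (auto intro!: AE_I2 power_mono)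
  with f show fL: "f \<in> L2 M" by (simp add: L2_def)
  have "(\<lambda>n. \<integral>x. (cmod (f x - F n x))\<^sup>2 \<partial>M) \<longlonglongrightarrow> (\<integral>x. 0 \<partial>M)"
  proof (rule integral_dominated_convergence)
    show "integrable M (\<lambda>x. 4 * (w x)\<^sup>2)" using w by simp
    show "AE x in M. (\<lambda>n. (cmod (f x - F n x))\<^sup>2) \<longlonglongrightarrow> 0"
    proof (rule AE_I2)
      fix x assume "x \<in> space M"
      then have "(\<lambda>n. (cmod (f x - F n x))\<^sup>2) \<longlonglongrightarrow> (cmod (f x - f x))\<^sup>2"
        by (intro tendsto_intros lim)
      then show "(\<lambda>n. (cmod (f x - F n x))\<^sup>2) \<longlonglongrightarrow> 0" by simp
    qed
    show "AE x in M. norm ((cmod (f x - F n x))\<^sup>2) \<le> 4 * (w x)\<^sup>2" for n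
    proof (rule AE_I2)
      fix x assume x: "x \<in> space M"
      have "cmod (f x - F n x) \<le> 2 * w x"
        using norm_triangle_ineq4[of "f x" "F n x"] fw[OF x] bnd[OF x, of n] by linarith
      then have "(cmod (f x - F n x))\<^sup>2 \<le> (2 * w x)\<^sup>2" by (intro power_mono) auto
      then show "norm ((cmod (f x - F n x))\<^sup>2) \<le> 4 * (w x)\<^sup>2" by (simp add: power_mult_distrib)
    qed
  qed (use f Fm in \<open>auto\<close>)
  then have *: "(\<lambda>n. (L2_norm M (\<lambda>x. f x - F n x))\<^sup>2) \<longlonglongrightarrow> 0" by (simp add: L2_norm_power2)
  then show "\<exists>g\<in>L2_closure M B. (L2_norm M (\<lambda>x. f x - g x))\<^sup>2 < e" if e: "e > 0" for e
  proof -
    obtain n where "(L2_norm M (\<lambda>x. f x - F n x))\<^sup>2 < e"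
      using eventually_happens'[OF _ order_tendstoD(2)[OF * e]] by auto
    with F show ?thesis by blast
  qed
qed

text \<open>The sets whose indicators lie in the closure form a Dynkin system containing
  \<open>G\<close>, hence all measurable sets. Simple functions follow by linearity, and
  \<open>f\<close> as the limit of simple functions bounded by \<open>2 * |f|\<close>.\<close>

lemma L2_closure_borel_sets:
  assumes B: "B \<subseteq> L2 M" and M: "finite_measure M" "sets M = sigma_sets UNIV G"
    and G: "Int_stable G" "\<And>A. A \<in> G \<Longrightarrow> (\<lambda>x. of_bool (x \<in> A)) \<in> L2_closure M B"
    and UNIV: "(\<lambda>x. 1) \<in> L2_closure M B"
    and f: "f \<in> L2 M"
  shows "f \<in> L2_closure M B"
proof -
  interpret finite_measure M by fact
  have space: "space M = UNIV"
    by (metis M(2) UNIV_I sets.top sets.sets_into_space sigma_sets_top top.extremum_uniqueI)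
  have ind: "(\<lambda>x. of_bool (x \<in> A)) \<in> L2_closure M B" if "A \<in> sets M" for A
    using G(1) subset_UNIV[of G, folded Pow_UNIV] that[unfolded M(2)]
  proof (induction rule: sigma_sets_induct_disjoint)
    case (compl A)
    have "(\<lambda>x. 1 + (- 1) * of_bool (x \<in> A)) \<in> L2_closure M B"
      by (intro L2_closure_add L2_closure_cmult B UNIV compl)
    also have "(\<lambda>x. 1 + (- 1) * of_bool (x \<in> A)) = (\<lambda>x. of_bool (x \<in> UNIV - A) :: complex)"
      by auto
    finally show ?case .
  next
    case (union A)
    show ?case
    proof (rule L2_closure_dominated_limit[OF B])
      show "(\<lambda>x. \<Sum>i<n. of_bool (x \<in> A i)) \<in> L2_closure M B" for n
        by (intro L2_closure_sum B union)
      \<comment> \<open>By disjointness the partial sums are themselves indicators, so the constant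
        1 is a majorant; it is square integrable as the measure is finite.\<close>
      have sum: "(\<Sum>i<n. of_bool (x \<in> A i)) = (of_bool (x \<in> (\<Union>i<n. A i)) :: complex)" for n x
      proof (cases "\<exists>i<n. x \<in> A i")
        case True
        then obtain i where i: "i < n" "x \<in> A i" by auto
        then have "(\<Sum>j<n. of_bool (x \<in> A j)) = (\<Sum>j<n. if j = i then 1 else 0 :: complex)"
          using union(1) by (intro sum.cong) (auto simp: disjoint_family_on_def)
        also have "\<dots> = 1" using i by simp
        finally show ?thesis using i by auto
      next
        case False
        then show ?thesis by auto
      qed
      show "cmod (\<Sum>i<n. of_bool (x \<in> A i)) \<le> 1" for n x
        unfolding sum by simp
      show "(\<lambda>n. \<Sum>i<n. of_bool (x \<in> A i)) \<longlonglongrightarrow> (of_bool (x \<in> (\<Union>i. A i)) :: complex)" for x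
      proof (cases "x \<in> (\<Union>i. A i)")
        case True
        then obtain i where i: "x \<in> A i" by auto
        have "\<forall>\<^sub>F n in sequentially. of_bool (x \<in> (\<Union>i<n. A i)) = (1 :: complex)"
          using eventually_gt_at_top[of i] by eventually_elim (use i in auto)
        with True show ?thesis unfolding sum by (auto intro: tendsto_eventually)
      qed (simp add: sum)
      have [measurable]: "A i \<in> sets M" for i using union(2) M(2) by auto
      show "(\<lambda>x. of_bool (x \<in> (\<Union>i. A i))) \<in> borel_measurable M" by measurable
    qed (auto simp: space)
  qed (use G L2_closure_zero[OF B] in auto)
  have simple: "s \<in> L2_closure M B" if s: "simple_function M s" for s
  proof -
    have "(\<lambda>x. \<Sum>y\<in>range s. y * of_bool (x \<in> s -` {y})) \<in> L2_closure M B"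
      using s by (intro L2_closure_sum L2_closure_cmult B ind) (auto simp: simple_function_def space)
    also have "(\<lambda>x. \<Sum>y\<in>range s. y * of_bool (x \<in> s -` {y})) = s"
    proof
      fix x
      have "finite (range s)" using s by (simp add: simple_function_def space)
      then have "(\<Sum>y\<in>range s. if s x = y then y else 0) = s x" by simp
      then show "(\<Sum>y\<in>range s. y * of_bool (x \<in> s -` {y})) = s x"
        by (simp add: of_bool_def if_distrib cong: if_cong)
    qed
    finally show ?thesis .
  qed
  have fm: "f \<in> borel_measurable M" using f by (simp add: L2_def)
  from borel_measurable_implies_sequence_metric[OF this, of 0]
  obtain F where F: "\<And>i. simple_function M (F i)" "\<And>x. (\<lambda>i. F i x) \<longlonglongrightarrow> f x"
    "\<And>i x. cmod (F i x) \<le> 2 * cmod (f x)"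
    by (auto simp: space)
  show ?thesis
    by (rule L2_closure_dominated_limit[OF B simple[OF F(1)] fm, of "\<lambda>x. 2 * cmod (f x)"])
       (use f fm F in \<open>auto simp: L2_def power_mult_distrib\<close>)
qed

text \<open>If \<open>q\<close> in the span is close to \<open>f\<close>, orthogonality gives
  \<open>||f||^2 = <f - q, f>\<close>, which is at most \<open>||f - q|| * ||f||\<close>. Hence the
  norm of \<open>f\<close> is arbitrarily small.\<close>

lemma L2_inner_closure_eq_0:
  assumes B: "B \<subseteq> L2 M" and f: "f \<in> L2_closure M B"
    and orth: "\<And>b. b \<in> B \<Longrightarrow> L2_inner M f b = 0"
  shows "AE x in M. f x = 0"
proof -
  have fL: "f \<in> L2 M" using f by (simp add: L2_closure_def)
  have p: "L2_inner M p f = 0" if "p \<in> cspan B" for p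
    using that
  proof (induction rule: cspan.induct)
    case zero
    show ?case by (simp add: L2_inner_def)
  next
    case (step p b c)
    have "L2_inner M (\<lambda>x. p x - (- c) * b x) f = 0 - (- c) * 0"
      using step B orth[OF step(2)] cnj_L2_inner[of M f b]
      by (subst L2_inner_diff_cmult) (auto intro: cspan_L2 fL)
    then show ?case by simp
  qed
  have "L2_norm M f \<le> 0 + e" if "e > 0" for e
  proof (cases "L2_norm M f = 0")
    case False
    have "e\<^sup>2 > 0" using that by simp
    then obtain q where q: "q \<in> cspan B" "(L2_norm M (\<lambda>x. f x - q x))\<^sup>2 < e\<^sup>2"
      by (rule L2_closureE[OF f])
    have qL: "q \<in> L2 M" by (rule cspan_L2[OF q(1) B])
    have "L2_inner M (\<lambda>x. f x - 1 * q x) f = of_real ((L2_norm M f)\<^sup>2)"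
      by (simp only: L2_inner_diff_cmult[OF fL qL fL] p[OF q(1)] L2_inner_self mult_zero_right diff_zero)
    then have "(L2_norm M f)\<^sup>2 = cmod (L2_inner M (\<lambda>x. f x - q x) f)"
      by (simp del: of_real_power)
    also have "\<dots> \<le> L2_norm M (\<lambda>x. f x - q x) * L2_norm M f"
      by (intro L2_Cauchy_Schwarz L2_diff fL qL)
    finally have "L2_norm M f \<le> L2_norm M (\<lambda>x. f x - q x)"
      using False L2_norm_nonneg[of M f] by (simp add: power2_eq_square)
    also have "\<dots> < e"
      using q(2) that by (intro power_less_imp_less_base[of _ 2 e]) auto
    finally show ?thesis by simp
  qed (use that in simp)
  then have "L2_norm M f \<le> 0" by (rule field_le_epsilon)
  then have "L2_norm M f = 0" using L2_norm_nonneg[of M f] by linarith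
  then show ?thesis using L2_norm_eq_0_iff[OF fL] by simp
qed

subsection \<open>Density of the polynomials\<close>

text \<open>Up to the factor \<open>\<i>\<close>, the exponent runs through all real linear forms on the plane.\<close>

definition wave :: "complex \<Rightarrow> complex \<Rightarrow> complex" where
  "wave u z = exp (\<i> * of_real (2 * Re (u * z)))"

text \<open>The powers \<open>(1 - v\<^sup>k)\<close> to the \<open>2\<^sup>k\<close> tend to the indicator of \<open>v < 1/2\<close> for \<open>v \<noteq> 1/2\<close> in \<open>[0, 1]\<close>. The shift
  by \<open>1/n\<^sup>2\<close> breaks the tie at \<open>t = 0\<close>.\<close>

definition half_line_approx :: "nat \<Rightarrow> real \<Rightarrow> real" where
  "half_line_approx n t = (1 - ((1 - sin (t / real n - 1 / (real n)\<^sup>2)) / 2) ^ (n ^ 3)) ^ (2 ^ (n ^ 3))"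

text \<open>With \<open>v\<close> the inner power, \<open>q\<close> is
  \<open>2 ^ (n ^ 3) * v\<close>. The Bernoulli inequality bounds
  \<open>(1 - v) ^ (2 ^ (n ^ 3))\<close> below by \<open>1 - q\<close>, and
  \<open>1 - v \<le> exp (- v)\<close> bounds it above by \<open>exp (- q)\<close>.\<close>

lemma half_line_approx_bounds:
  fixes n :: nat and t :: real
  defines "q \<equiv> (1 - sin (t / real n - 1 / (real n)\<^sup>2)) ^ (n ^ 3)"
  shows "0 \<le> half_line_approx n t" "half_line_approx n t \<le> 1"
    "1 - q \<le> half_line_approx n t" "half_line_approx n t \<le> exp (- q)"
proof -
  define v where "v = ((1 - sin (t / real n - 1 / (real n)\<^sup>2)) / 2) ^ (n ^ 3)"
  have v: "0 \<le> v" "v \<le> 1"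
    unfolding v_def by (intro zero_le_power power_le_one; simp add: sin_ge_minus_one[THEN order_trans[rotated]])+
  have q: "q = 2 ^ (n ^ 3) * v" by (simp add: v_def q_def power_divide)
  have eq: "half_line_approx n t = (1 - v) ^ (2 ^ (n ^ 3))" by (simp add: half_line_approx_def v_def)
  show "0 \<le> half_line_approx n t" "half_line_approx n t \<le> 1"
    unfolding eq using v by (auto intro!: zero_le_power power_le_one)
  show "1 - q \<le> half_line_approx n t"
    using Bernoulli_inequality[of "- v" "2 ^ (n ^ 3)"] v by (simp add: eq q)
  have "1 - v \<le> exp (- v)" using exp_ge_add_one_self[of "- v"] by simp
  then have "(1 - v) ^ (2 ^ (n ^ 3)) \<le> exp (- v) ^ (2 ^ (n ^ 3))"
    using v by (intro power_mono) auto
  also have "\<dots> = exp (- q)" by (simp add: q flip: exp_of_nat_mult)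
  finally show "half_line_approx n t \<le> exp (- q)" unfolding eq .
qed

text \<open>For \<open>t > 0\<close> the quantity \<open>?q n\<close> decays roughly like
  \<open>exp (- t * n^2)\<close>, and for \<open>t < 0\<close> it grows correspondingly. At
  \<open>t = 0\<close> only the shift is left and \<open>?q n\<close> is about
  \<open>(1 + 1/n^2) ^ (n^3)\<close>, which still diverges: this is the purpose of the exponent
  \<open>n ^ 3\<close>.\<close>

lemma half_line_approx_tendsto:
  "(\<lambda>n. half_line_approx n t) \<longlonglongrightarrow> of_bool (0 < t)"
proof -
  let ?q = "\<lambda>n. (1 - sin (t / real n - 1 / (real n)\<^sup>2)) ^ (n ^ 3)"
  note b = half_line_approx_bounds[where t = t]
  consider "t > 0" | "t = 0" | "t < 0" by linarith
  then show ?thesis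
  proof cases
    case 1
    then have "(\<lambda>n. 1 - ?q n) \<longlonglongrightarrow> 1" by real_asymp
    then have "(\<lambda>n. half_line_approx n t) \<longlonglongrightarrow> 1"
      by (rule real_tendsto_sandwich[rotated 2, OF _ tendsto_const[of 1]]) (use b in auto)
    with 1 show ?thesis by simp
  next
    case 2
    then have "filterlim ?q at_top sequentially" by simp real_asymp
    then have "(\<lambda>n. exp (- ?q n)) \<longlonglongrightarrow> 0"
      by (intro filterlim_compose[OF exp_at_bot] filterlim_compose[OF filterlim_uminus_at_bot_at_top])
    then have "(\<lambda>n. half_line_approx n t) \<longlonglongrightarrow> 0"
      by (rule real_tendsto_sandwich[rotated 2, OF tendsto_const[of 0]]) (use b in auto)
    with 2 show ?thesis by simp
  next
    case 3
    then have "filterlim ?q at_top sequentially" by real_asymp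
    then have "(\<lambda>n. exp (- ?q n)) \<longlonglongrightarrow> 0"
      by (intro filterlim_compose[OF exp_at_bot] filterlim_compose[OF filterlim_uminus_at_bot_at_top])
    then have "(\<lambda>n. half_line_approx n t) \<longlonglongrightarrow> 0"
      by (rule real_tendsto_sandwich[rotated 2, OF tendsto_const[of 0]]) (use b in auto)
    with 3 show ?thesis by simp
  qed
qed

section \<open>Trigonometric polynomials\<close>

lemma wave_mult: "wave u z * wave v z = wave (u + v) z"
  by (simp add: wave_def exp_add[symmetric] algebra_simps)

lemma wave_0: "wave 0 z = 1"
  by (simp add: wave_def)

lemma cspan_wave_mult:
  "f \<in> cspan (range wave) \<Longrightarrow> g \<in> cspan (range wave) \<Longrightarrow> (\<lambda>x. f x * g x) \<in> cspan (range wave)"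
  by (rule cspan_mult) (auto simp: wave_mult intro: cspan_base)

lemma cspan_wave_const: "(\<lambda>_. c) \<in> cspan (range wave)"
  using cspan_cmult[OF cspan_base[of "wave 0" "range wave"], of c] by (simp add: wave_0)

lemma cspan_wave_power: "f \<in> cspan (range wave) \<Longrightarrow> (\<lambda>x. f x ^ n) \<in> cspan (range wave)"
  by (induction n) (auto intro: cspan_wave_mult cspan_wave_const)

lemma cspan_wave_sin: "(\<lambda>z. of_real (sin (2 * Re (u * z) + a))) \<in> cspan (range wave)"
proof -
  have "(\<lambda>z. (exp (\<i> * of_real a) / (2 * \<i>)) * wave u z + (- exp (- (\<i> * of_real a)) / (2 * \<i>)) * wave (- u) z)
      \<in> cspan (range wave)"
    by (intro cspan_add cspan_cmult cspan_base) auto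
  also have "(\<lambda>z. (exp (\<i> * of_real a) / (2 * \<i>)) * wave u z + (- exp (- (\<i> * of_real a)) / (2 * \<i>)) * wave (- u) z)
      = (\<lambda>z. of_real (sin (2 * Re (u * z) + a)))"
  proof
    fix z
    define b where "b = 2 * Re (u * z)"
    have w: "wave u z = exp (\<i> * of_real b)" "wave (- u) z = exp (- (\<i> * of_real b))"
      by (simp_all only: wave_def b_def mult_minus_left uminus_complex.sel of_real_minus mult_minus_right)
    have e: "exp (\<i> * of_real (b + a)) = exp (\<i> * of_real a) * exp (\<i> * of_real b)"
      "exp (- (\<i> * of_real (b + a))) = exp (- (\<i> * of_real a)) * exp (- (\<i> * of_real b))"
      unfolding exp_add[symmetric] by (simp_all add: algebra_simps)
    show "(exp (\<i> * of_real a) / (2 * \<i>)) * wave u z + (- exp (- (\<i> * of_real a)) / (2 * \<i>)) * wave (- u) z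
      = of_real (sin (2 * Re (u * z) + a))"
      unfolding b_def[symmetric] w sin_of_real[symmetric] sin_exp_eq e
      by (simp add: diff_divide_distrib right_diff_distrib mult.assoc)
  qed
  finally show ?thesis .
qed

text \<open>The approximant is a polynomial in the sine of an affine form, and trigonometric
  polynomials form an algebra.\<close>

lemma cspan_wave_half_line_approx:
  "(\<lambda>z. of_real (half_line_approx n (2 * Re (u * z) + a))) \<in> cspan (range wave)"
proof -
  define v where "v = of_real (1 / real n) * u"
  define b where "b = a / real n - 1 / (real n)\<^sup>2"
  have arg: "(2 * Re (u * z) + a) / real n - 1 / (real n)\<^sup>2 = 2 * Re (v * z) + b" for z
  proof -
    have "Re (of_real c * w) = c * Re w" for c w by simp
    then have "Re (v * z) = 1 / real n * Re (u * z)"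
      unfolding v_def mult.assoc .
    then show ?thesis by (simp add: b_def add_divide_distrib)
  qed
  define S where "S = (\<lambda>z. complex_of_real (sin (2 * Re (v * z) + b)))"
  have S: "S \<in> cspan (range wave)" unfolding S_def by (rule cspan_wave_sin)
  have eq: "complex_of_real (half_line_approx n (2 * Re (u * z) + a)) =
      (1 + (- 1) * ((1/2) * (1 + (- 1) * S z)) ^ (n ^ 3)) ^ (2 ^ (n ^ 3))" for z
  proof -
    have "complex_of_real ((1 - ((1 - s) / 2) ^ k) ^ K)
        = (1 + (- 1) * ((1/2) * (1 + (- 1) * of_real s)) ^ k) ^ K" for s k K
      by simp
    then show ?thesis
      unfolding half_line_approx_def arg S_def .
  qed
  show ?thesis
    unfolding eq by (intro cspan_wave_power cspan_wave_const cspan_add cspan_cmult S)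
qed

section \<open>Approximation of plane waves by polynomials\<close>

definition ito_polys :: "real \<Rightarrow> (complex \<Rightarrow> complex) set" where
  "ito_polys \<rho> = range (\<lambda>(m, n). ito m n (of_real (- \<rho>)))"

lemma ito_polys_I: "ito m n (of_real (- \<rho>)) \<in> ito_polys \<rho>"
  unfolding ito_polys_def by (rule range_eqI[of _ _ "(m, n)"]) simp

lemma ito_polys_E:
  assumes "f \<in> ito_polys \<rho>"
  obtains m n where "f = ito m n (of_real (- \<rho>))"
  using assms by (auto simp: ito_polys_def)

lemma ito_polys_L2: "\<rho> > 0 \<Longrightarrow> ito_polys \<rho> \<subseteq> L2 (gauss_measure \<rho>)"
  by (auto elim!: ito_polys_E intro!: subgaussian_L2 subgaussian_ito)

text \<open>Both recursions of \<open>ito\<close>, solved for the product with \<open>z\<close> or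
  with its conjugate, express that product through polynomials of neighbouring indices.\<close>

lemma cspan_ito_linear_mult:
  assumes "f \<in> cspan (ito_polys \<rho>)"
  shows "(\<lambda>z. (a * z + b * cnj z) * f z) \<in> cspan (ito_polys \<rho>)"
proof (rule cspan_subset[OF assms])
  fix f assume "f \<in> ito_polys \<rho>"
  then obtain m n where f: "f = ito m n (of_real (- \<rho>))" by (rule ito_polys_E)
  let ?c = "of_real (- \<rho>) :: complex"
  have "(\<lambda>z. (a * ito (Suc m) n ?c z + (- a * ?c * of_nat n) * ito m (n - 1) ?c z)
      + (b * ito m (Suc n) ?c z + (- b * ?c * of_nat m) * ito (m - 1) n ?c z)) \<in> cspan (ito_polys \<rho>)"
    by (intro cspan_add cspan_cmult cspan_base ito_polys_I)
  also have "(\<lambda>z. (a * ito (Suc m) n ?c z + (- a * ?c * of_nat n) * ito m (n - 1) ?c z)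
      + (b * ito m (Suc n) ?c z + (- b * ?c * of_nat m) * ito (m - 1) n ?c z))
      = (\<lambda>z. (a * z + b * cnj z) * f z)"
    unfolding f ito_cnj_mult ito.simps by (simp add: fun_eq_iff algebra_simps)
  finally show "(\<lambda>z. (a * z + b * cnj z) * f z) \<in> cspan (ito_polys \<rho>)" .
qed

lemma cspan_ito_linear_power: "(\<lambda>z. (a * z + b * cnj z) ^ k) \<in> cspan (ito_polys \<rho>)"
proof (induction k)
  case 0
  show ?case using cspan_base[OF ito_polys_I[of 0 0 \<rho>]] by (simp add: ito.simps[abs_def])
next
  case (Suc k)
  then show ?case using cspan_ito_linear_mult[OF Suc] by simp
qed

lemma wave_L2: "\<rho> > 0 \<Longrightarrow> wave u \<in> L2 (gauss_measure \<rho>)"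
proof -
  assume rho: "\<rho> > 0"
  interpret prob_space "gauss_measure \<rho>" by (rule prob_space_gauss_measure[OF rho])
  have "wave u \<in> borel_measurable borel"
    unfolding wave_def[abs_def] by (intro borel_measurable_continuous_onI continuous_intros)
  then show ?thesis by (simp add: L2_def wave_def)
qed

text \<open>The squared Taylor remainder carries \<open>((n + 1)!)^2\<close> in the denominator,
  while the moment of order \<open>2(n + 1)\<close> contributes only \<open>(n + 1)!\<close>. One
  factorial survives, so the bound is a term of a convergent exponential series.\<close>

lemma wave_in_L2_closure:
  assumes rho: "\<rho> > 0"
  shows "wave u \<in> L2_closure (gauss_measure \<rho>) (ito_polys \<rho>)"
  unfolding L2_closure_def mem_Collect_eq
proof (intro conjI allI impI wave_L2[OF rho])
  fix e :: real assume e: "e > 0"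
  let ?M = "gauss_measure \<rho>"
  define T where "T n z = (\<Sum>k\<le>n. (\<i> * of_real (2 * Re (u * z))) ^ k / fact k)" for n :: nat and z
  have T: "T n \<in> cspan (ito_polys \<rho>)" for n
  proof -
    have lin: "\<i> * of_real (2 * Re (u * z)) = \<i> * u * z + \<i> * cnj u * cnj z" for z
      by (simp add: complex_eq_iff algebra_simps)
    have "(\<lambda>z. \<Sum>k\<le>n. (1 / fact k) * (\<i> * u * z + \<i> * cnj u * cnj z) ^ k) \<in> cspan (ito_polys \<rho>)"
      by (intro cspan_sum cspan_cmult cspan_ito_linear_power)
    then show ?thesis unfolding T_def[abs_def] lin by simp
  qed
  have bound: "(L2_norm ?M (\<lambda>z. wave u z - T n z))\<^sup>2 \<le> (4 * (cmod u)\<^sup>2 * \<rho>) ^ Suc n / fact (Suc n)" for n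
  proof -
    have TL: "T n \<in> L2 ?M" by (rule cspan_L2[OF T ito_polys_L2[OF rho]])
    let ?C = "(2 * cmod u) ^ (2 * Suc n) / (fact (Suc n))\<^sup>2"
    have mom: "has_bochner_integral ?M (\<lambda>z. ?C * cmod z ^ (2 * Suc n)) (?C * (\<rho> ^ Suc n * fact (Suc n)))"
      by (intro has_bochner_integral_mult_right gauss_measure_moment rho)
    have "(\<integral>z. (cmod (wave u z - T n z))\<^sup>2 \<partial>?M) \<le> (\<integral>z. ?C * cmod z ^ (2 * Suc n) \<partial>?M)"
    proof (rule integral_mono)
      show "integrable ?M (\<lambda>z. (cmod (wave u z - T n z))\<^sup>2)"
        using L2_diff[OF wave_L2[OF rho] TL] by (simp add: L2_def)
      show "integrable ?M (\<lambda>z. ?C * cmod z ^ (2 * Suc n))"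
        using mom by (simp only: has_bochner_integral_iff)
      fix z
      have "cmod (wave u z - T n z) \<le> \<bar>2 * Re (u * z)\<bar> ^ Suc n / fact (Suc n)"
        unfolding wave_def T_def by (rule iexp_approx1)
      also have "\<dots> \<le> (2 * cmod u * cmod z) ^ Suc n / fact (Suc n)"
        using abs_Re_le_cmod[of "u * z"]
        by (intro divide_right_mono power_mono) (auto simp: norm_mult abs_mult)
      finally have "(cmod (wave u z - T n z))\<^sup>2 \<le> ((2 * cmod u * cmod z) ^ Suc n / fact (Suc n))\<^sup>2"
        by (rule power_mono) simp
      also have "\<dots> = ?C * cmod z ^ (2 * Suc n)"
        by (simp only: power_mult_distrib power_divide power_mult[symmetric] mult.commute[of 2]
            times_divide_eq_left)
      finally show "(cmod (wave u z - T n z))\<^sup>2 \<le> ?C * cmod z ^ (2 * Suc n)" .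
    qed
    also have "\<dots> = ?C * (\<rho> ^ Suc n * fact (Suc n))"
      using mom by (simp only: has_bochner_integral_iff)
    also have "\<dots> = (4 * (cmod u)\<^sup>2 * \<rho>) ^ Suc n / fact (Suc n)"
    proof -
      have "(2 * cmod u) ^ (2 * Suc n) = (4 * (cmod u)\<^sup>2) ^ Suc n"
        unfolding power_mult by (simp add: power_mult_distrib)
      moreover have "a / f\<^sup>2 * (b * f) = a * b / f" if "f \<noteq> 0" for a b f :: real
        using that by (simp add: power2_eq_square)
      ultimately show ?thesis
        by (simp only: power_mult_distrib[of "4 * (cmod u)\<^sup>2" \<rho>] fact_nonzero not_False_eq_True)
    qed
    finally show ?thesis by (simp only: L2_norm_power2)
  qed
  have "(\<lambda>n. (4 * (cmod u)\<^sup>2 * \<rho>) ^ n / fact n) \<longlonglongrightarrow> 0"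
    using summable_LIMSEQ_zero[OF summable_exp[of "4 * (cmod u)\<^sup>2 * \<rho>"]]
    by (simp add: divide_inverse mult.commute)
  from order_tendstoD(2)[OF LIMSEQ_Suc[OF this] e]
  obtain n where "(4 * (cmod u)\<^sup>2 * \<rho>) ^ Suc n / fact (Suc n) < e"
    using eventually_happens'[OF sequentially_bot] by blast
  with bound[of n] T[of n]
  show "\<exists>p\<in>cspan (ito_polys \<rho>). (L2_norm ?M (\<lambda>z. wave u z - p z))\<^sup>2 < e"
    by (intro bexI[of _ "T n"]) auto
qed

lemma cspan_wave_subset_closure:
  assumes rho: "\<rho> > 0" and f: "f \<in> cspan (range wave)"
  shows "f \<in> L2_closure (gauss_measure \<rho>) (ito_polys \<rho>)"
  using f
proof (induction rule: cspan.induct)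
  case zero
  show ?case by (rule L2_closure_zero[OF ito_polys_L2[OF rho]])
next
  case (step f b c)
  then show ?case
    using wave_in_L2_closure[OF rho]
    by (intro L2_closure_add L2_closure_cmult ito_polys_L2 rho) auto
qed

section \<open>From quadrants to all square integrable functions\<close>

definition quadrants :: "complex set set" where
  "quadrants = range (\<lambda>(a, b). {z. a < Re z \<and> b < Im z})"

text \<open>A coordinate half-plane is the union of the quadrants whose other coordinate exceeds
  \<open>-k\<close>, over all natural \<open>k\<close>, and such half-planes generate the Borel
  sets.\<close>

lemma sets_borel_quadrants: "sets (borel :: complex measure) = sigma_sets UNIV quadrants"
proof -
  have "(borel :: complex measure) = sigma UNIV (range (\<lambda>(a, b). {z. a < Re z \<and> b < Im z}))"
  proof (rule borel_eq_sigmaI2[OF borel_eq_halfspace_greater, of _ UNIV])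
    let ?S = "sigma UNIV (range (\<lambda>(a, b). {z. a < Re z \<and> b < Im z}))"
    fix a :: real and i :: complex
    assume "(a, i) \<in> UNIV \<times> Basis"
    then consider "i = 1" | "i = \<i>" by (auto simp: Basis_complex_def)
    then have "\<exists>Q. {x. a < x \<bullet> i} = (\<Union>k::nat. Q k) \<and> range Q \<subseteq> range (\<lambda>(a, b). {z. a < Re z \<and> b < Im z})"
    proof cases
      case 1
      have "\<exists>k::nat. - real k < Im z" for z
        using reals_Archimedean2[of "- Im z"] by (auto simp: minus_less_iff)
      then show ?thesis
        unfolding 1 by (intro exI[of _ "\<lambda>k. {z. a < Re z \<and> - real k < Im z}"]) auto
    next
      case 2
      have "\<exists>k::nat. - real k < Re z" for z
        using reals_Archimedean2[of "- Re z"] by (auto simp: minus_less_iff)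
      then show ?thesis
        unfolding 2 by (intro exI[of _ "\<lambda>k. {z. - real k < Re z \<and> a < Im z}"]) auto
    qed
    then obtain Q where Q: "{x. a < x \<bullet> i} = (\<Union>k::nat. Q k)"
      "range Q \<subseteq> range (\<lambda>(a, b). {z. a < Re z \<and> b < Im z})" by auto
    have "Q k \<in> sets ?S" for k
      using Q(2) by (auto intro!: sigma_sets.Basic)
    then show "{x. a < x \<bullet> i} \<in> sets ?S" unfolding Q(1) by (intro sets.countable_UN) auto
  qed auto
  then have "sets (borel :: complex measure) = sets (sigma UNIV quadrants)"
    unfolding quadrants_def by (rule arg_cong)
  then show ?thesis by simp
qed

lemma Int_stable_quadrants: "Int_stable quadrants"
proof (rule Int_stableI)
  fix A B assume "A \<in> quadrants" "B \<in> quadrants"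
  then obtain a b c d where "A = {z. a < Re z \<and> b < Im z}" "B = {z. c < Re z \<and> d < Im z}"
    by (auto simp: quadrants_def)
  then have "A \<inter> B = {z. max a c < Re z \<and> max b d < Im z}" by auto
  then show "A \<inter> B \<in> quadrants"
    unfolding quadrants_def by (intro range_eqI[of _ _ "(max a c, max b d)"]) simp
qed

lemma ito_polys_dense:
  assumes rho: "\<rho> > 0" and f: "f \<in> L2 (gauss_measure \<rho>)"
  shows "f \<in> L2_closure (gauss_measure \<rho>) (ito_polys \<rho>)"
proof -
  let ?M = "gauss_measure \<rho>"
  interpret prob_space ?M by (rule prob_space_gauss_measure[OF rho])
  note B = ito_polys_L2[OF rho]
  show ?thesis
  proof (rule L2_closure_borel_sets[OF B finite_measure_axioms _ Int_stable_quadrants _ _ f])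
    show "sets ?M = sigma_sets UNIV quadrants" by (simp add: sets_borel_quadrants)
    show "(\<lambda>_. 1) \<in> L2_closure ?M (ito_polys \<rho>)"
      by (rule cspan_wave_subset_closure[OF rho cspan_wave_const])
    fix A assume "A \<in> quadrants"
    then obtain a b where A: "A = {z. a < Re z \<and> b < Im z}" by (auto simp: quadrants_def)
    let ?F = "\<lambda>n z. complex_of_real (half_line_approx n (Re z - a)) * of_real (half_line_approx n (Im z - b))"
    show "(\<lambda>z. of_bool (z \<in> A)) \<in> L2_closure ?M (ito_polys \<rho>)"
    proof (rule L2_closure_dominated_limit[OF B, of ?F])
      show "?F n \<in> L2_closure ?M (ito_polys \<rho>)" for n
        \<comment> \<open>The form \<open>2 * Re (u * z)\<close> is \<open>Re z\<close> for
          \<open>u = 1/2\<close> and \<open>Im z\<close> for \<open>u = - \<i>/2\<close>.\<close>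
        using cspan_wave_mult[OF cspan_wave_half_line_approx[of n "1/2" "- a"]
            cspan_wave_half_line_approx[of n "- \<i>/2" "- b"]]
        by (intro cspan_wave_subset_closure rho) simp
      show "(\<lambda>n. ?F n z) \<longlonglongrightarrow> of_bool (z \<in> A)" for z
      proof -
        have "(\<lambda>n. ?F n z) \<longlonglongrightarrow> of_real (of_bool (0 < Re z - a)) * of_real (of_bool (0 < Im z - b))"
          by (intro tendsto_intros half_line_approx_tendsto)
        also have "complex_of_real (of_bool (0 < Re z - a)) * of_real (of_bool (0 < Im z - b)) = of_bool (z \<in> A)"
          by (simp add: A)
        finally show ?thesis .
      qed
      show "cmod (?F n z) \<le> 1" for n z
        using half_line_approx_bounds(1,2)
        by (auto simp: norm_mult intro!: mult_le_one)
      have "A \<in> sets borel"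
        using sets_borel_quadrants \<open>A \<in> quadrants\<close> by auto
      then show "(\<lambda>z. of_bool (z \<in> A)) \<in> borel_measurable ?M" by simp
    qed auto
  qed
qed

subsection \<open>Eigenfunctions of the generator\<close>

text \<open>The real part determines \<open>m + n\<close>; as \<open>\<Omega> \<noteq> 0\<close>,
  the imaginary part determines \<open>m - n\<close>.\<close>

lemma ou_eigenvalue_inject:
  assumes "r > 0" "\<Omega> \<noteq> 0" "ou_eigenvalue r \<Omega> m n = ou_eigenvalue r \<Omega> m' n'"
  shows "m = m' \<and> n = n'"
proof -
  have "(real m + real n) * r = (real m' + real n') * r" "(real m - real n) * \<Omega> = (real m' - real n') * \<Omega>"
    using assms(3) by (auto simp: ou_eigenvalue_def complex_eq_iff algebra_simps)
  then have "real m + real n = real m' + real n'" "real m - real n = real m' - real n'"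
    using assms(1,2) by simp_all
  then have "real m = real m'" "real n = real n'" by linarith+
  then show ?thesis by simp
qed

text \<open>A nonzero \<open>f\<close> has a nonzero coefficient by density, which fixes
  \<open>lam\<close> and the index pair. Subtracting the projection onto that polynomial leaves a
  function orthogonal to all of them, hence null.\<close>

lemma eigenfunction_ou_unique:
  assumes rho: "\<rho> > 0" and r: "r > 0" and om: "\<Omega> \<noteq> 0"
    and A: "A = generator (gauss_measure \<rho>) (ou_semigroup r \<Omega> \<rho>)"
    and f: "eigenfunction (gauss_measure \<rho>) A lam f"
  shows "\<exists>m n c. c \<noteq> 0 \<and> lam = ou_eigenvalue r \<Omega> m n \<and>
    (AE z in gauss_measure \<rho>. f z = c * ito m n (of_real (- \<rho>)) z)"
proof -
  let ?M = "gauss_measure \<rho>" and ?J = "\<lambda>m n. ito m n (of_real (- \<rho>))"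
  have fL: "f \<in> L2 ?M" and f0: "\<not> (AE z in ?M. f z = 0)"
    using f by (auto simp: eigenfunction_def)
  note B = ito_polys_L2[OF rho]
  note coeff = eigenfunction_coefficient[OF rho r A]
  note eig = eigenfunction_ito[OF rho r A]
  have JL: "?J m n \<in> L2 ?M" for m n using eig by (simp add: eigenfunction_def)
  have complete: "AE z in ?M. g z = 0" if "g \<in> L2 ?M" "\<And>m n. L2_inner ?M g (?J m n) = 0" for g
    using that by (intro L2_inner_closure_eq_0[OF B ito_polys_dense[OF rho]]) (auto elim!: ito_polys_E)
  obtain m n where mn: "lam = ou_eigenvalue r \<Omega> m n"
    using complete[OF fL] coeff[OF f] f0 by blast
  have JJ: "L2_inner ?M (?J m n) (?J m n) \<noteq> 0"
    using eig[of m n] L2_norm_eq_0_iff[OF JL] by (simp add: L2_inner_self eigenfunction_def)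
  define c where "c = L2_inner ?M f (?J m n) / L2_inner ?M (?J m n) (?J m n)"
  have "L2_inner ?M (\<lambda>z. f z - c * ?J m n z) (?J k l) = 0" for k l
  proof (cases "k = m \<and> l = n")
    case True
    then show ?thesis using JJ by (simp only: L2_inner_diff_cmult[OF fL JL JL]) (simp add: c_def)
  next
    case False
    then have "ou_eigenvalue r \<Omega> m n \<noteq> ou_eigenvalue r \<Omega> k l"
      using ou_eigenvalue_inject[OF r om] by blast
    \<comment> \<open>The coefficient lemma is used twice: for \<open>f\<close>, and for the
      polynomial \<open>?J m n\<close> as an eigenfunction itself, which yields the mutual
      orthogonality of the polynomials.\<close>
    then have "L2_inner ?M f (?J k l) = 0" "L2_inner ?M (?J m n) (?J k l) = 0"
      using coeff[OF f, of k l] coeff[OF eig, of m n k l] mn by auto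
    then show ?thesis by (simp only: L2_inner_diff_cmult[OF fL JL JL]) simp
  qed
  then have "AE z in ?M. f z - c * ?J m n z = 0"
    by (intro complete L2_diff L2_cmult fL JL)
  then have ae: "AE z in ?M. f z = c * ?J m n z" by eventually_elim simp
  with f0 have "c \<noteq> 0" by auto
  with mn ae show ?thesis by blast
qed

theorem theorem2p7:
  fixes r \<sigma> \<Omega> \<rho> :: real
  assumes "r > 0" and "\<sigma>\<^sup>2 > 0" and "\<Omega> \<noteq> 0" and "\<rho> = 2 * \<sigma>\<^sup>2 / r"
  shows
    "(\<forall>m n. (\<forall>z. ou_diff_expr r \<sigma> \<Omega> (\<lambda>w. hermite_laguerre_ito m n w \<rho>) z =
              ou_eigenvalue r \<Omega> m n * hermite_laguerre_ito m n z \<rho>) \<and>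
       eigenfunction (ou_measure r \<sigma>) (ou_operator r \<sigma> \<Omega>) (ou_eigenvalue r \<Omega> m n)
         (\<lambda>z. hermite_laguerre_ito m n z \<rho>)) \<and>
     (\<forall>lam f. eigenfunction (ou_measure r \<sigma>) (ou_operator r \<sigma> \<Omega>) lam f \<longrightarrow>
       (\<exists>m n c. c \<noteq> 0 \<and> lam = ou_eigenvalue r \<Omega> m n \<and>
          (AE z in ou_measure r \<sigma>. f z = c * hermite_laguerre_ito m n z \<rho>))) \<and>
     pure_point_spectrum (ou_measure r \<sigma>) (ou_operator r \<sigma> \<Omega>)"
proof -
  have rho: "\<rho> > 0" using assms by simp
  let ?M = "gauss_measure \<rho>"
  have M: "ou_measure r \<sigma> = ?M" by (rule ou_measure_eq[OF assms(1,4)])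
  have A: "ou_operator r \<sigma> \<Omega> = generator ?M (ou_semigroup r \<Omega> \<rho>)"
    by (simp add: ou_operator_def M assms(4))
  have J: "hermite_laguerre_ito m n z \<rho> = ito m n (of_real (- \<rho>)) z" for m n z
    using rho by (intro hermite_laguerre_ito_eq) simp
  note eig = eigenfunction_ito[OF rho assms(1) A]
  have "pure_point_spectrum ?M (ou_operator r \<sigma> \<Omega>)"
    unfolding pure_point_spectrum_def
  proof (intro ballI allI impI)
    fix f and e :: real assume f: "f \<in> L2 ?M" and e: "e > 0"
    then obtain p where p: "p \<in> cspan (ito_polys \<rho>)" "(L2_norm ?M (\<lambda>z. f z - p z))\<^sup>2 < e\<^sup>2"
      using L2_closureE[OF ito_polys_dense[OF rho f], of "e\<^sup>2"] by auto
    \<comment> \<open>The approximating element of the span is made explicit as a finite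
      combination, all of whose members are eigenfunctions.\<close>
    obtain F c where F: "finite F" "F \<subseteq> ito_polys \<rho>" "p = (\<lambda>z. \<Sum>h\<in>F. c h * h z)"
      using cspan_explicit[OF p(1)] by auto
    have "\<forall>h\<in>F. \<exists>lam. eigenfunction ?M (ou_operator r \<sigma> \<Omega>) lam h"
      using F(2) eig by (blast elim: ito_polys_E)
    moreover have "L2_norm ?M (\<lambda>z. f z - (\<Sum>h\<in>F. c h * h z)) < e"
      using p(2) e unfolding F(3) by (intro power_less_imp_less_base[of _ 2 e]) auto
    ultimately show "\<exists>F c. finite F \<and> (\<forall>h\<in>F. \<exists>lam. eigenfunction ?M (ou_operator r \<sigma> \<Omega>) lam h) \<and>
        L2_norm ?M (\<lambda>z. f z - (\<Sum>h\<in>F. c h * h z)) < e"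
      using F(1) by blast
  qed
  then show ?thesis
    unfolding M J
    using ou_diff_expr_ito[OF assms(1,4)] eig eigenfunction_ou_unique[OF rho assms(1,3) A] by blast
qed

end
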